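(* Let $0<\kappa<1$ and $C>0$. There exist a positive integer $N$ and a constant $c_0>0$, both depending only on $\kappa$ and $C$, such that the following holds. Let $\mu$ be a $(\kappa,C)$-measure on $\mathbb{R}$ supported on $[-C,C]$, and let $K:=\operatorname{spt}\mu$. Then $$\left|NK^{(N)}-NK^{(N)}\right|\ge c_0 .$$
   Context: $|\cdot|$ denotes Lebesgue measure on $\mathbb{R}$. A $(\kappa,C)$-measure on $\mathbb{R}$ is a Radon probability measure $\mu$ on $\mathbb{R}$ such that $\mu(B(x,r))\le C r^\kappa$ for all $x\in\operatorname{spt}\mu$ and all $r>0$. For $A\subset\mathbb{R}$ and a positive integer $N$, the $N$-fold sum-set is $NA:=\{a_1+\cdots+a_N: a_j\in A\}$ and the $N$-fold product-set is $A^{(N)}:=\{a_1\cdots a_N: a_j\in A\}$; thus $NK^{(N)}$ is the $N$-fold sum-set of $K^{(N)}$. For $X,Y\subset\mathbb{R}$, $X-Y:=\{x-y:x\in X,\,y\in Y\}$. *)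

theory Defs
  imports "HOL-Probability.Probability"
begin

definition spt :: "'a::topological_space measure \<Rightarrow> 'a set" where
  "spt \<mu> = {x. \<forall>U. open U \<longrightarrow> x \<in> U \<longrightarrow> emeasure \<mu> U > 0}"

(* Finite Borel measures on the real line are automatically Radon (inner_regular, outer_regular
   in HOL-Analysis.Regularity), so the Radon condition is not restated: real_distribution says
   exactly "Borel probability measure on the real line". *)
definition kappa_C_measure :: "real \<Rightarrow> real \<Rightarrow> real measure \<Rightarrow> bool" where
  "kappa_C_measure \<kappa> C \<mu> \<longleftrightarrow> real_distribution \<mu> \<and>
     (\<forall>x\<in>spt \<mu>. \<forall>r>0. measure \<mu> (cball x r) \<le> C * r powr \<kappa>)"

definition sumset :: "nat \<Rightarrow> real set \<Rightarrow> real set" where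
  "sumset N A = {\<Sum>j<N. a j | a. \<forall>j<N. a j \<in> A}"

definition prodset :: "nat \<Rightarrow> real set \<Rightarrow> real set" where
  "prodset N A = {\<Prod>j<N. a j | a. \<forall>j<N. a j \<in> A}"

(* X - Y on sets is set-theoretic difference in HOL, so the algebraic one gets its own name. *)
definition diffset :: "real set \<Rightarrow> real set \<Rightarrow> real set" where
  "diffset X Y = {x - y | x y. x \<in> X \<and> y \<in> Y}"

end

(* The argument is a quantitative version of the Edgar-Miller theorem on Borel subrings of the reals.
   Choose k with kappa * k >= 2. By a Marstrand-type averaging argument, for every scale delta = 2^-J
   some linear form x_1 y_1 + ... + x_k y_k with coefficients in [0,1] maps the k-fold power of
   mu to a measure of energy O(delta) at scale delta, so the image of K^k meets at least a constant
   times 1/delta intervals of length delta. A Steinhaus-type argument shows that boundedly many sums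
   and differences of such a set are O(delta)-dense in [-1,1], and a limit of the forms as delta -> 0
   maps A^k onto a set containing [-1,1], where A = M K - M K.
   Variables are then removed one at a time. If k >= 2, there is a vector e with e_i of size at least 1
   for some i, with entries in a bounded sum-set of A, on which the form vanishes. Multiplying a
   representation of t / e_i by e_i eliminates x_i, at the cost of replacing A by a sum of
   products. When one variable with coefficient in [0,1] is left, A itself contains [-1,1].
   The degree of the products is finally adjusted to N by multiplying with a power of an element of K that
   is not too small. *)
theory Submission
  imports Defs
begin

subsection \<open>Sum-sets of product-sets\<close>

lemma sumset_0 [simp]: "sumset 0 A = {0}"
  by (auto simp: sumset_def)

lemma prodset_0 [simp]: "prodset 0 A = {1}"
  by (auto simp: prodset_def)

lemma sumset_Suc: "sumset (Suc n) A = (\<lambda>(s, a). s + a) ` (sumset n A \<times> A)"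
proof (intro equalityI subsetI)
  fix x assume "x \<in> sumset (Suc n) A"
  then obtain f where f: "x = (\<Sum>j<Suc n. f j)" "\<forall>j<Suc n. f j \<in> A"
    unfolding sumset_def by blast
  have "(\<Sum>j<n. f j) \<in> sumset n A"
    unfolding sumset_def using f(2) by (intro CollectI exI[of _ f]) simp
  with f show "x \<in> (\<lambda>(s, a). s + a) ` (sumset n A \<times> A)"
    by (intro image_eqI[where x = "((\<Sum>j<n. f j), f n)"]) auto
next
  fix x assume "x \<in> (\<lambda>(s, a). s + a) ` (sumset n A \<times> A)"
  then obtain s a where x: "x = s + a" "s \<in> sumset n A" "a \<in> A" by auto
  then obtain f where f: "s = (\<Sum>j<n. f j)" "\<forall>j<n. f j \<in> A"
    unfolding sumset_def by blast
  have "x = (\<Sum>j<Suc n. (f(n := a)) j)" "\<forall>j<Suc n. (f(n := a)) j \<in> A"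
    using x f by (auto simp: less_Suc_eq)
  then show "x \<in> sumset (Suc n) A"
    unfolding sumset_def by blast
qed

lemma prodset_Suc: "prodset (Suc n) A = (\<lambda>(s, a). s * a) ` (prodset n A \<times> A)"
proof (intro equalityI subsetI)
  fix x assume "x \<in> prodset (Suc n) A"
  then obtain f where f: "x = (\<Prod>j<Suc n. f j)" "\<forall>j<Suc n. f j \<in> A"
    unfolding prodset_def by blast
  have "(\<Prod>j<n. f j) \<in> prodset n A"
    unfolding prodset_def using f(2) by (intro CollectI exI[of _ f]) simp
  with f show "x \<in> (\<lambda>(s, a). s * a) ` (prodset n A \<times> A)"
    by (intro image_eqI[where x = "((\<Prod>j<n. f j), f n)"]) auto
next
  fix x assume "x \<in> (\<lambda>(s, a). s * a) ` (prodset n A \<times> A)"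
  then obtain s a where x: "x = s * a" "s \<in> prodset n A" "a \<in> A" by auto
  then obtain f where f: "s = (\<Prod>j<n. f j)" "\<forall>j<n. f j \<in> A"
    unfolding prodset_def by blast
  have "x = (\<Prod>j<Suc n. (f(n := a)) j)" "\<forall>j<Suc n. (f(n := a)) j \<in> A"
    using x f by (auto simp: less_Suc_eq)
  then show "x \<in> prodset (Suc n) A"
    unfolding prodset_def by blast
qed

lemma sumset_SucI: "s \<in> sumset n A \<Longrightarrow> a \<in> A \<Longrightarrow> s + a \<in> sumset (Suc n) A"
  by (force simp: sumset_Suc)

lemma prodset_SucI: "s \<in> prodset n A \<Longrightarrow> a \<in> A \<Longrightarrow> s * a \<in> prodset (Suc n) A"
  by (force simp: prodset_Suc)

lemma sumset_1: "sumset (Suc 0) A = A"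
  by (auto simp: sumset_Suc image_def)

lemma prodset_1: "prodset (Suc 0) A = A"
  by (auto simp: prodset_Suc image_def)

lemma diffset_image: "diffset X Y = (\<lambda>(x, y). x - y) ` (X \<times> Y)"
  by (auto simp: diffset_def)

lemma compact_sumset: "compact A \<Longrightarrow> compact (sumset n A)"
  by (induction n)
     (auto simp: sumset_Suc split_def intro!: compact_continuous_image compact_Times continuous_intros)

lemma compact_prodset: "compact A \<Longrightarrow> compact (prodset n A)"
  by (induction n)
     (auto simp: prodset_Suc split_def intro!: compact_continuous_image compact_Times continuous_intros)

lemma compact_diffset: "compact X \<Longrightarrow> compact Y \<Longrightarrow> compact (diffset X Y)"
  by (auto simp: diffset_image split_def intro!: compact_continuous_image compact_Times continuous_intros)

lemma sumset_add: "x \<in> sumset m A \<Longrightarrow> y \<in> sumset n A \<Longrightarrow> x + y \<in> sumset (m + n) A"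
proof (induction n arbitrary: y)
  case (Suc n)
  then obtain s a where "y = s + a" "s \<in> sumset n A" "a \<in> A" by (auto simp: sumset_Suc)
  with sumset_SucI[OF Suc.IH[of s], of a] Suc.prems show ?case by (simp add: add.assoc)
qed auto

lemma prodset_mult: "x \<in> prodset m A \<Longrightarrow> y \<in> prodset n A \<Longrightarrow> x * y \<in> prodset (m + n) A"
proof (induction n arbitrary: y)
  case (Suc n)
  then obtain s a where "y = s * a" "s \<in> prodset n A" "a \<in> A" by (auto simp: prodset_Suc)
  with prodset_SucI[OF Suc.IH[of s], of a] Suc.prems show ?case by (simp add: mult.assoc)
qed auto

lemma sumset_mult_elem:
  assumes "\<And>a b. a \<in> A \<Longrightarrow> b \<in> B \<Longrightarrow> a * b \<in> E" and "x \<in> sumset m A" and "b \<in> B"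
  shows "x * b \<in> sumset m E"
  using assms(2)
proof (induction m arbitrary: x)
  case (Suc m)
  then obtain s a where "x = s + a" "s \<in> sumset m A" "a \<in> A" by (auto simp: sumset_Suc)
  with sumset_SucI[OF Suc.IH[of s] assms(1)[of a b]] \<open>b \<in> B\<close> show ?case
    by (simp add: distrib_right)
qed auto

lemma sumset_mult:
  assumes "\<And>a b. a \<in> A \<Longrightarrow> b \<in> B \<Longrightarrow> a * b \<in> E" and "x \<in> sumset m A" and "y \<in> sumset n B"
  shows "x * y \<in> sumset (m * n) E"
  using assms(3)
proof (induction n arbitrary: y)
  case (Suc n)
  then obtain s b where "y = s + b" "s \<in> sumset n B" "b \<in> B" by (auto simp: sumset_Suc)
  with Suc have "x * y = x * b + x * s" "x * s \<in> sumset (m * n) E"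
    by (auto simp: algebra_simps)
  moreover have "x * b \<in> sumset m E"
    by (rule sumset_mult_elem[OF _ assms(2) \<open>b \<in> B\<close>]) (use assms(1) in auto)
  ultimately show ?case using sumset_add[of "x * b" m E] by simp
qed auto

lemma abs_sumset_le:
  assumes "\<And>a. a \<in> A \<Longrightarrow> \<bar>a\<bar> \<le> B" and "x \<in> sumset m A"
  shows "\<bar>x\<bar> \<le> real m * B"
  using assms(2)
proof (induction m arbitrary: x)
  case (Suc m)
  then obtain s a where "x = s + a" "s \<in> sumset m A" "a \<in> A" by (auto simp: sumset_Suc)
  with Suc.IH[of s] assms(1)[of a] show ?case by (auto simp: algebra_simps)
qed auto

lemma abs_prodset_le:
  assumes "\<And>a. a \<in> A \<Longrightarrow> \<bar>a\<bar> \<le> B" and "0 \<le> B" and "x \<in> prodset m A"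
  shows "\<bar>x\<bar> \<le> B ^ m"
  using assms(3)
proof (induction m arbitrary: x)
  case (Suc m)
  then obtain s a where "x = s * a" "s \<in> prodset m A" "a \<in> A" by (auto simp: prodset_Suc)
  with mult_mono[of "\<bar>s\<bar>" "B ^ m" "\<bar>a\<bar>" B] Suc.IH[of s] assms(1)[of a] assms(2) show ?case
    by (simp add: abs_mult mult.commute)
qed auto

section \<open>Arithmetic of differences of sum-sets of product-sets\<close>

text \<open>The degree \<open>d\<close> of the products and the number \<open>m\<close> of summands
  are tracked separately, because eliminating a variable changes them at different rates. The set of
  the theorem is \<open>sumprod N N K\<close>.\<close>

definition sumprod :: "nat \<Rightarrow> nat \<Rightarrow> real set \<Rightarrow> real set" where
  "sumprod d m K = diffset (sumset m (prodset d K)) (sumset m (prodset d K))"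

lemma sumprodI:
  "p \<in> sumset m (prodset d K) \<Longrightarrow> q \<in> sumset m (prodset d K) \<Longrightarrow> p - q \<in> sumprod d m K"
  by (auto simp: sumprod_def diffset_def)

lemma sumprodE:
  assumes "x \<in> sumprod d m K"
  obtains p q where "x = p - q" "p \<in> sumset m (prodset d K)" "q \<in> sumset m (prodset d K)"
  using assms by (auto simp: sumprod_def diffset_def)

lemma compact_sumprod: "compact K \<Longrightarrow> compact (sumprod d m K)"
  by (simp add: sumprod_def compact_diffset compact_sumset compact_prodset)

lemma prodset_nonempty: "K \<noteq> {} \<Longrightarrow> prodset d K \<noteq> {}"
  by (induction d) (auto simp: prodset_Suc)

lemma sumset_nonempty: "A \<noteq> {} \<Longrightarrow> sumset m A \<noteq> {}"
  by (induction m) (auto simp: sumset_Suc)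

lemma zero_in_sumprod:
  assumes "K \<noteq> {}"
  shows "0 \<in> sumprod d m K"
proof -
  obtain p where "p \<in> sumset m (prodset d K)"
    using sumset_nonempty[OF prodset_nonempty[OF assms]] by blast
  from sumprodI[OF this this] show ?thesis by simp
qed

lemma sumprod_uminus: "x \<in> sumprod d m K \<Longrightarrow> - x \<in> sumprod d m K"
  by (metis sumprodE sumprodI minus_diff_eq)

lemma sumprod_add:
  assumes "x \<in> sumprod d m K" and "y \<in> sumprod d n K"
  shows "x + y \<in> sumprod d (m + n) K"
proof -
  obtain p q where 1: "x = p - q" "p \<in> sumset m (prodset d K)" "q \<in> sumset m (prodset d K)"
    using assms(1) by (rule sumprodE)
  obtain p' q' where 2: "y = p' - q'" "p' \<in> sumset n (prodset d K)" "q' \<in> sumset n (prodset d K)"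
    using assms(2) by (rule sumprodE)
  have "(p + p') - (q + q') \<in> sumprod d (m + n) K"
    using 1 2 by (intro sumprodI sumset_add)
  moreover have "(p + p') - (q + q') = x + y" using 1 2 by simp
  ultimately show ?thesis by simp
qed

lemma sumprod_diff:
  "x \<in> sumprod d m K \<Longrightarrow> y \<in> sumprod d n K \<Longrightarrow> x - y \<in> sumprod d (m + n) K"
  using sumprod_add[of x d m K "- y" n] sumprod_uminus[of y d n K] by simp

text \<open>Adding 0, written as p - p, pads the number of summands for free. The degree admits no
  such padding.\<close>

lemma sumprod_mono:
  assumes "K \<noteq> {}" and "m \<le> n" and "x \<in> sumprod d m K"
  shows "x \<in> sumprod d n K"
  using sumprod_add[OF assms(3) zero_in_sumprod[OF assms(1), of d "n - m"]] assms(2) by simp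

text \<open>Expanding (p - q)(p' - q') = (p p' + q q') - (p q' + q p') leaves two products on each
  side, hence the factor 2.\<close>

lemma sumprod_mult:
  assumes "x \<in> sumprod d m K" and "y \<in> sumprod d' n K"
  shows "x * y \<in> sumprod (d + d') (2 * (m * n)) K"
proof -
  obtain p q where 1: "x = p - q" "p \<in> sumset m (prodset d K)" "q \<in> sumset m (prodset d K)"
    using assms(1) by (rule sumprodE)
  obtain p' q' where 2: "y = p' - q'" "p' \<in> sumset n (prodset d' K)" "q' \<in> sumset n (prodset d' K)"
    using assms(2) by (rule sumprodE)
  have *: "u * v \<in> sumset (m * n) (prodset (d + d') K)"
    if "u \<in> sumset m (prodset d K)" "v \<in> sumset n (prodset d' K)" for u v
    by (rule sumset_mult[OF _ that]) (rule prodset_mult)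
  have "(p * p' + q * q') - (p * q' + q * p') \<in> sumprod (d + d') (m * n + m * n) K"
    using 1 2 by (intro sumprodI sumset_add *)
  moreover have "(p * p' + q * q') - (p * q' + q * p') = x * y"
    unfolding 1 2 by (simp add: algebra_simps)
  ultimately show ?thesis by (simp add: mult_2)
qed

lemma sumprod_nat_mult:
  assumes "x \<in> sumprod d m K"
  shows "real n * x \<in> sumprod d (n * m) K"
proof (induction n)
  case 0
  show ?case by (auto simp: sumprod_def diffset_def)
next
  case (Suc n)
  from sumprod_add[OF assms Suc] show ?case by (simp add: algebra_simps)
qed

lemma sumprod_int_mult:
  assumes "x \<in> sumprod d m K"
  shows "of_int n * x \<in> sumprod d (nat \<bar>n\<bar> * m) K"
proof (cases "0 \<le> n")
  case True
  then show ?thesis using sumprod_nat_mult[OF assms, of "nat n"] by simp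
next
  case False
  then show ?thesis using sumprod_uminus[OF sumprod_nat_mult[OF assms, of "nat (- n)"]]
    by (simp add: abs_if)
qed

text \<open>A bound depending only on \<open>C\<close>, \<open>d\<close> and \<open>m\<close>: it
  supplies a constant that serves all \<open>K\<close> at once when a variable is
  eliminated.\<close>

lemma abs_sumprod_le:
  assumes "K \<subseteq> {-C..C}" and "0 \<le> C" and "x \<in> sumprod d m K"
  shows "\<bar>x\<bar> \<le> 2 * real m * C ^ d"
proof -
  obtain p q where 1: "x = p - q" "p \<in> sumset m (prodset d K)" "q \<in> sumset m (prodset d K)"
    using assms(3) by (rule sumprodE)
  have K: "\<bar>a\<bar> \<le> C" if "a \<in> K" for a using assms(1) that by force
  have P: "\<bar>a\<bar> \<le> C ^ d" if "a \<in> prodset d K" for a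
    by (rule abs_prodset_le[OF K assms(2) that])
  have "\<bar>p\<bar> \<le> real m * C ^ d" "\<bar>q\<bar> \<le> real m * C ^ d"
    using abs_sumset_le[OF P] 1 by auto
  then show ?thesis using 1 by simp
qed

lemma power_in_prodset: "z \<in> K \<Longrightarrow> z ^ n \<in> prodset n K"
  using prodset_SucI[of "z ^ n" n K z for n] by (induction n) (auto simp: mult.commute)

text \<open>Multiplying every product by the same power of one element raises the degree at the
  price of a dilation by \<open>z ^ n\<close>.\<close>

lemma sumprod_pad_degree:
  assumes "x \<in> sumprod d m K" and "z \<in> K"
  shows "z ^ n * x \<in> sumprod (d + n) m K"
proof -
  obtain p q where 1: "x = p - q" "p \<in> sumset m (prodset d K)" "q \<in> sumset m (prodset d K)"
    using assms(1) by (rule sumprodE)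
  have *: "u * z ^ n \<in> sumset m (prodset (d + n) K)" if "u \<in> sumset m (prodset d K)" for u
    by (rule sumset_mult_elem[OF prodset_mult that power_in_prodset[OF assms(2)]])
  have "p * z ^ n - q * z ^ n \<in> sumprod (d + n) m K"
    using 1 by (intro sumprodI *)
  then show ?thesis unfolding 1 by (simp add: algebra_simps)
qed

subsection \<open>Eliminating a variable\<close>

text \<open>An index set is used instead of tuples, so that a variable can be deleted without
  renumbering. The coefficients \<open>x\<close> are arbitrary reals; only the arguments of the form
  are taken from \<open>A\<close>.\<close>

definition covers :: "'i set \<Rightarrow> ('i \<Rightarrow> real) \<Rightarrow> real set \<Rightarrow> bool" where
  "covers I x A \<longleftrightarrow> (\<forall>t. \<bar>t\<bar> \<le> 1 \<longrightarrow> (\<exists>a. (\<forall>i\<in>I. a i \<in> A) \<and> (\<Sum>i\<in>I. x i * a i) = t))"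

lemma coversE:
  assumes "covers I x A" and "\<bar>t\<bar> \<le> 1"
  obtains a where "\<And>i. i \<in> I \<Longrightarrow> a i \<in> A" "(\<Sum>i\<in>I. x i * a i) = t"
  using assms by (auto simp: covers_def)

text \<open>The kernel element is \<open>e = n b - m' a - c\<close>: here \<open>a\<close> represents \<open>1\<close> and has a coordinate
  \<open>p\<close> that is not small, \<open>b\<close> is \<open>a p\<close> moved to another coordinate \<open>q\<close>, and \<open>c\<close> represents the
  fractional part of the value \<open>n s\<close> of the form at \<open>n b\<close>. If the integer part \<open>m'\<close> is large, then so is
  \<open>e p\<close>; if not, then \<open>e q\<close> is large, because \<open>n\<close> beats all other terms.\<close>
lemma covers_kernel:
  fixes x :: "'i \<Rightarrow> real"
  assumes "finite I" and "2 \<le> card I" and x: "\<And>i. i \<in> I \<Longrightarrow> \<bar>x i\<bar> \<le> 1"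
    and cov: "covers I x (sumprod d m K)" and "K \<noteq> {}"
    and D: "\<And>a. a \<in> sumprod d m K \<Longrightarrow> \<bar>a\<bar> \<le> real D"
    and n: "n = card I * (1 + D + card I * (D + 1) * D)"
  obtains e i where "i \<in> I" "1 \<le> \<bar>e i\<bar>" "\<And>j. j \<in> I \<Longrightarrow> e j \<in> sumprod d ((n + n * D + 2) * m) K"
    "(\<Sum>j\<in>I. x j * e j) = 0"
proof -
  define k where "k = card I"
  have k2: "2 \<le> k" using assms by (simp add: k_def)
  obtain a where a: "\<And>i. i \<in> I \<Longrightarrow> a i \<in> sumprod d m K" and sa: "(\<Sum>i\<in>I. x i * a i) = 1"
    using coversE[OF cov, of 1] by auto
  have "\<exists>p\<in>I. 1 / real k \<le> \<bar>a p\<bar>"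
  proof (rule ccontr)
    assume "\<not> ?thesis"
    then have lt: "\<bar>a p\<bar> < 1 / real k" if "p \<in> I" for p using that by (auto simp: not_le)
    have "1 \<le> (\<Sum>i\<in>I. \<bar>x i * a i\<bar>)" using sa sum_abs[of "\<lambda>i. x i * a i" I] by simp
    also have "\<dots> \<le> (\<Sum>i\<in>I. \<bar>a i\<bar>)"
      by (intro sum_mono) (use x in \<open>auto simp: abs_mult intro!: mult_left_le_one_le\<close>)
    also have "\<dots> < (\<Sum>i\<in>I. 1 / real k)"
      by (rule sum_strict_mono) (use assms lt in auto)
    also have "\<dots> = 1" using k2 by (simp add: k_def)
    finally show False by simp
  qed
  then obtain p where p: "p \<in> I" "1 / real k \<le> \<bar>a p\<bar>" by blast
  have "I \<noteq> {p}" using k2 by (auto simp: k_def)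
  then obtain q where q: "q \<in> I" "q \<noteq> p" using p by blast
  define b where "b = (\<lambda>i. if i = q then a p else 0)"
  define s where "s = x q * a p"
  have sb: "(\<Sum>i\<in>I. x i * b i) = s"
    using q \<open>finite I\<close> by (simp add: b_def s_def if_distrib sum.delta cong: if_cong)
  have bI: "b i \<in> sumprod d m K" if "i \<in> I" for i
    using that a p zero_in_sumprod[OF \<open>K \<noteq> {}\<close>] by (auto simp: b_def)
  define m' where "m' = \<lfloor>real n * s\<rfloor>"
  have r: "\<bar>real n * s - of_int m'\<bar> \<le> 1" unfolding m'_def by linarith
  obtain c where c: "\<And>i. i \<in> I \<Longrightarrow> c i \<in> sumprod d m K"
    and sc: "(\<Sum>i\<in>I. x i * c i) = real n * s - of_int m'"
    using coversE[OF cov r] by auto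
  define e where "e = (\<lambda>i. real n * b i - of_int m' * a i - c i)"
  have se: "(\<Sum>j\<in>I. x j * e j) = 0"
  proof -
    have "(\<Sum>j\<in>I. x j * e j) = real n * (\<Sum>j\<in>I. x j * b j) - of_int m' * (\<Sum>j\<in>I. x j * a j)
        - (\<Sum>j\<in>I. x j * c j)"
    proof -
      have "x j * e j = real n * (x j * b j) - of_int m' * (x j * a j) - x j * c j" for j
        by (simp add: e_def algebra_simps)
      then show ?thesis by (simp only: sum_subtractf sum_distrib_left)
    qed
    then show ?thesis by (simp add: sb sa sc)
  qed
  have "\<bar>s\<bar> \<le> real D"
    unfolding s_def abs_mult using x[OF q(1)] D[OF a[OF p(1)]] mult_mono[of "\<bar>x q\<bar>" 1 "\<bar>a p\<bar>" "real D"]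
    by simp
  then have "\<bar>real n * s\<bar> \<le> real (n * D)" by (simp add: abs_mult mult_left_mono)
  then have "\<bar>m'\<bar> \<le> int (n * D) + 1" unfolding m'_def by linarith
  then have m'le: "nat \<bar>m'\<bar> \<le> n * D + 1" by linarith
  have eI: "e j \<in> sumprod d ((n + n * D + 2) * m) K" if "j \<in> I" for j
  proof -
    have "e j \<in> sumprod d (n * m + nat \<bar>m'\<bar> * m + m) K"
      unfolding e_def using that by (intro sumprod_diff sumprod_nat_mult sumprod_int_mult a bI c)
    moreover have "n * m + nat \<bar>m'\<bar> * m + m \<le> (n + n * D + 2) * m"
      using mult_right_mono[OF m'le, of m] by (simp add: algebra_simps)
    ultimately show ?thesis using sumprod_mono[OF \<open>K \<noteq> {}\<close>] by blast
  qed
  \<comment> \<open>Above the threshold \<open>k * (D + 1)\<close> the bound \<open>1 / k\<close>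
    for \<open>a p\<close> makes the term with m' at least D + 1 at \<open>p\<close>, while
    \<open>c p\<close> removes at most D. Below it, the factor in brackets in \<open>n\<close> is
    exactly 1 more than what the other two terms can remove at \<open>q\<close>.\<close>
  have "1 \<le> \<bar>e p\<bar> \<or> 1 \<le> \<bar>e q\<bar>"
  proof (cases "real k * (real D + 1) \<le> \<bar>real_of_int m'\<bar>")
    case True
    have "real D + 1 = real k * (real D + 1) * (1 / real k)" using k2 by simp
    also have "\<dots> \<le> \<bar>real_of_int m'\<bar> * \<bar>a p\<bar>"
      using True p by (intro mult_mono) auto
    finally have "real D + 1 \<le> \<bar>of_int m' * a p\<bar>" by (simp add: abs_mult)
    moreover have "e p = - (of_int m' * a p) - c p" using q by (simp add: e_def b_def)
    ultimately have "1 \<le> \<bar>e p\<bar>" using D[OF c[OF p(1)]] by linarith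
    then show ?thesis ..
  next
    case False
    have "real n * (1 / real k) \<le> real n * \<bar>a p\<bar>" using p by (intro mult_left_mono) auto
    moreover have "real n * (1 / real k) = 1 + real D + real k * (real D + 1) * real D"
      using k2 by (simp add: n k_def[symmetric] field_simps)
    moreover have "\<bar>of_int m' * a q\<bar> \<le> real k * (real D + 1) * real D"
      unfolding abs_mult using False D[OF a[OF q(1)]] by (intro mult_mono) auto
    moreover have "e q = real n * a p - of_int m' * a q - c q" by (simp add: e_def b_def)
    moreover have "\<bar>real n * a p\<bar> = real n * \<bar>a p\<bar>" by (simp add: abs_mult)
    ultimately have "1 \<le> \<bar>e q\<bar>" using D[OF c[OF q(1)]] by linarith
    then show ?thesis ..
  qed
  then show thesis using that p q eI se by blast
qed

text \<open>Let \<open>a\<close> represent t / e_i, which lies in [-1,1] because e_i has size at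
  least 1. The vector e_i a - a_i e has i-th coordinate 0, and the form takes the value t on it
  because it vanishes on \<open>e\<close>. Each coordinate is a difference of two products, so the
  degree doubles and the number of summands becomes 4 n m.\<close>

lemma covers_remove:
  fixes x :: "'i \<Rightarrow> real"
  assumes "finite I" and cov: "covers I x (sumprod d m K)" and i: "i \<in> I" "1 \<le> \<bar>e i\<bar>"
    and e: "\<And>j. j \<in> I \<Longrightarrow> e j \<in> sumprod d n K" and se: "(\<Sum>j\<in>I. x j * e j) = 0"
  shows "covers (I - {i}) x (sumprod (d + d) (4 * (n * m)) K)"
  unfolding covers_def
proof (intro allI impI)
  fix t :: real assume t: "\<bar>t\<bar> \<le> 1"
  have "\<bar>t / e i\<bar> \<le> 1" using t i by (simp add: abs_divide divide_le_eq)
  from coversE[OF cov this] obtain a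
    where a: "\<And>j. j \<in> I \<Longrightarrow> a j \<in> sumprod d m K" and sa: "(\<Sum>j\<in>I. x j * a j) = t / e i"
    by blast
  have "(\<Sum>j\<in>I - {i}. x j * (e i * a j - e j * a i)) = (\<Sum>j\<in>I. x j * (e i * a j - e j * a i))"
    using i \<open>finite I\<close> by (simp add: sum.remove[of I i])
  also have "\<dots> = e i * (\<Sum>j\<in>I. x j * a j) - a i * (\<Sum>j\<in>I. x j * e j)"
    by (simp add: sum_distrib_left sum_subtractf algebra_simps)
  also have "\<dots> = t" using sa se i by auto
  finally have "(\<Sum>j\<in>I - {i}. x j * (e i * a j - e j * a i)) = t" .
  moreover have "e i * a j - e j * a i \<in> sumprod (d + d) (4 * (n * m)) K" if "j \<in> I - {i}" for j
    using sumprod_diff[OF sumprod_mult[OF e[OF i(1)] a] sumprod_mult[OF e a[OF i(1)]], of j j] that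
    by (simp add: mult.commute)
  ultimately show "\<exists>a. (\<forall>j\<in>I - {i}. a j \<in> sumprod (d + d) (4 * (n * m)) K) \<and>
      (\<Sum>j\<in>I - {i}. x j * a j) = t"
    by (intro exI[of _ "\<lambda>j. e i * a j - e j * a i"]) blast
qed

text \<open>Induction on the number of variables, with \<open>d\<close> and \<open>m\<close>
  arbitrary because each elimination changes them. The new parameters are chosen before
  \<open>K\<close>, \<open>I\<close> and \<open>x\<close>, which gives the uniformity of the
  theorem. With one variable left, its coefficient is nonzero since 1 is represented, and
  representing \<open>x i * t\<close> exhibits t itself.\<close>

lemma interval_subset_sumprod:
  fixes C :: real
  assumes "0 \<le> C"
  shows "\<exists>d' m'. \<forall>K (I :: 'i set) x. card I = Suc k \<and> K \<noteq> {} \<and> K \<subseteq> {-C..C} \<and>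
    (\<forall>i\<in>I. \<bar>x i\<bar> \<le> 1) \<and> covers I x (sumprod d m K) \<longrightarrow> {-1..1} \<subseteq> sumprod d' m' K"
proof (induction k arbitrary: d m)
  case 0
  have "{-1..1} \<subseteq> sumprod d m K"
    if I: "card I = Suc 0" and x: "\<forall>i\<in>I. \<bar>x i\<bar> \<le> 1" and cov: "covers I x (sumprod d m K)"
    for K and I :: "'i set" and x
  proof
    obtain i where i: "I = {i}" using I by (auto simp: card_1_singleton_iff)
    obtain a1 where "x i * a1 i = 1" using coversE[OF cov, of 1] by (auto simp: i)
    then have nz: "x i \<noteq> 0" by auto
    fix t :: real assume t: "t \<in> {-1..1}"
    have "\<bar>x i * t\<bar> \<le> 1"
      using t x i mult_mono[of "\<bar>x i\<bar>" 1 "\<bar>t\<bar>" 1] by (auto simp: abs_mult)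
    from coversE[OF cov this] obtain a where "a i \<in> sumprod d m K" "x i * a i = x i * t"
      by (auto simp: i)
    then show "t \<in> sumprod d m K" using nz by simp
  qed
  then show ?case by metis
next
  case (Suc k)
  \<comment> \<open>\<open>D\<close> bounds all elements of \<open>sumprod d m K\<close>, and
    \<open>n\<close> is the multiplier that the construction of a kernel vector requires for
    \<open>Suc (Suc k)\<close> variables. Neither depends on \<open>K\<close>.\<close>
  define D where "D = nat \<lceil>2 * real m * C ^ d\<rceil>"
  define n where "n = Suc (Suc k) * (1 + D + Suc (Suc k) * (D + 1) * D)"
  define n' where "n' = (n + n * D + 2) * m"
  obtain d' m' where dm: "\<forall>K (I :: 'i set) x. card I = Suc k \<and> K \<noteq> {} \<and> K \<subseteq> {-C..C} \<and>
    (\<forall>i\<in>I. \<bar>x i\<bar> \<le> 1) \<and> covers I x (sumprod (d + d) (4 * (n' * m)) K) \<longrightarrow> {-1..1} \<subseteq> sumprod d' m' K"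
    using Suc.IH[of "d + d" "4 * (n' * m)"] by (elim exE that)
  have "{-1..1} \<subseteq> sumprod d' m' K"
    if I: "card I = Suc (Suc k)" and K: "K \<noteq> {}" "K \<subseteq> {-C..C}"
      and x: "\<forall>i\<in>I. \<bar>x i\<bar> \<le> 1" and cov: "covers I x (sumprod d m K)"
    for K and I :: "'i set" and x
  proof -
    have fin: "finite I" using I card.infinite by fastforce
    have D: "\<bar>a\<bar> \<le> real D" if "a \<in> sumprod d m K" for a
      using abs_sumprod_le[OF K(2) assms that] unfolding D_def by linarith
    have card2: "2 \<le> card I" and n: "n = card I * (1 + D + card I * (D + 1) * D)"
      and x': "\<And>i. i \<in> I \<Longrightarrow> \<bar>x i\<bar> \<le> 1"
      using I x by (simp_all add: n_def)
    obtain e i where e: "i \<in> I" "1 \<le> \<bar>e i\<bar>" "\<And>j. j \<in> I \<Longrightarrow> e j \<in> sumprod d n' K"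
      "(\<Sum>j\<in>I. x j * e j) = 0"
      by (rule covers_kernel[OF fin card2 x' cov K(1) D n, folded n'_def]) (assumption | rule that)+
    have "covers (I - {i}) x (sumprod (d + d) (4 * (n' * m)) K)"
      by (rule covers_remove[OF fin cov e])
    moreover have "card (I - {i}) = Suc k" using I e fin by simp
    ultimately show ?thesis using dm K x by blast
  qed
  then show ?case by metis
qed

subsection \<open>Dense sets of integers\<close>

text \<open>The j-fold sum of S - S + {-1,0,1}. The slack \<open>u\<close> allows passing from an
  integer to its neighbour; after rescaling by the small scale it costs only a small error.\<close>

primrec int_walk :: "int set \<Rightarrow> nat \<Rightarrow> int set" where
  "int_walk S 0 = {0}"
| "int_walk S (Suc j) = {h + (s - s') + u | h s s' u. h \<in> int_walk S j \<and> s \<in> S \<and> s' \<in> S \<and> \<bar>u\<bar> \<le> 1}"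

lemma int_walk_SucI:
  "h \<in> int_walk S j \<Longrightarrow> s \<in> S \<Longrightarrow> s' \<in> S \<Longrightarrow> \<bar>u\<bar> \<le> 1 \<Longrightarrow> h + (s - s') + u \<in> int_walk S (Suc j)"
  by auto

text \<open>A step with s = s' moves by the slack alone: \<open>u = 0\<close> gives monotonicity in
  \<open>j\<close>, and \<open>u = 1\<close> reaches the successor of a point.\<close>

lemma int_walk_step:
  assumes "S \<noteq> {}" and "h \<in> int_walk S j" and "\<bar>u\<bar> \<le> 1"
  shows "h + u \<in> int_walk S (Suc j)"
proof -
  obtain s where "s \<in> S" using assms(1) by blast
  from int_walk_SucI[OF assms(2) this this assms(3)] show ?thesis by simp
qed

lemma int_walk_mono:
  assumes "S \<noteq> {}" and "i \<le> j"
  shows "int_walk S i \<subseteq> int_walk S j"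
  using assms(2)
proof (induction j rule: dec_induct)
  case (step n)
  then show ?case using int_walk_step[OF assms(1), of _ n 0] by auto
qed simp

text \<open>Let \<open>w j\<close> be the least natural number outside \<open>int_walk S j\<close>; it lies in \<open>int_walk S (Suc j)\<close>.
  Hence the translates of \<open>S\<close> by \<open>w 0, w 2, \<dots>, w (2 * q)\<close> are disjoint, and there is no room for them
  in \<open>{-L..2 * L}\<close>.\<close>
lemma int_walk_covers:
  fixes L y :: int
  assumes S: "S \<noteq> {}" "S \<subseteq> {-L..L}" and y: "0 \<le> y" "y \<le> L"
    and card: "3 * L + 1 < int (Suc q) * int (card S)"
  shows "y \<in> int_walk S (2 * q)"
proof (rule ccontr)
  assume ny: "y \<notin> int_walk S (2 * q)"
  have fin: "finite S" using S(2) finite_subset by blast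
  define w where "w j = (LEAST n. int n \<notin> int_walk S j)" for j
  have ex: "int (nat y) \<notin> int_walk S j" if "j \<le> 2 * q" for j
    using ny int_walk_mono[OF S(1) that] y by auto
  have w1: "int (w j) \<notin> int_walk S j" if "j \<le> 2 * q" for j
    unfolding w_def by (rule LeastI, rule ex[OF that])
  have w2: "int (w j) \<le> L" if "j \<le> 2 * q" for j
    using Least_le[of "\<lambda>n. int n \<notin> int_walk S j", OF ex[OF that]] y by (simp add: w_def)
  have w3: "int (w j) \<in> int_walk S (Suc j)" if "j \<le> 2 * q" for j
  proof -
    have "0 \<in> int_walk S j" using int_walk_mono[OF S(1), of 0 j] by simp
    then have "w j \<noteq> 0" using w1[OF that] by (metis of_nat_0)
    then have "int (w j - 1) \<in> int_walk S j"
      using not_less_Least[of "w j - 1" "\<lambda>n. int n \<notin> int_walk S j"] by (simp add: w_def)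
    from int_walk_step[OF S(1) this, of 1] \<open>w j \<noteq> 0\<close> show ?thesis by (simp add: of_nat_diff)
  qed
  \<comment> \<open>A common point would give w (2 i') = w (2 i) + s - s'. One step reaches w (2 i)
    and a second adds s - s', so w (2 i') would already lie in the walk of length 2 i + 2, which is
    at most 2 i'. This is why only even indices are used.\<close>
  have disj: "((+) (int (w (2 * i))) ` S) \<inter> ((+) (int (w (2 * i'))) ` S) = {}" if "i < i'" "i' \<le> q" for i i'
  proof (rule ccontr)
    assume "\<not> ?thesis"
    then obtain s s' where s: "s \<in> S" "s' \<in> S" "int (w (2 * i)) + s = int (w (2 * i')) + s'" by auto
    have "int (w (2 * i)) + (s - s') + 0 \<in> int_walk S (Suc (Suc (2 * i)))"
      using that by (intro int_walk_SucI w3 s) auto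
    moreover have "int (w (2 * i)) + (s - s') + 0 = int (w (2 * i'))" using s by simp
    moreover have "int_walk S (Suc (Suc (2 * i))) \<subseteq> int_walk S (2 * i')"
      using that by (intro int_walk_mono S) auto
    ultimately show False using w1[of "2 * i'"] that by (auto simp del: int_walk.simps)
  qed
  have "card (\<Union>i\<in>{..q}. (+) (int (w (2 * i))) ` S) = (\<Sum>i\<in>{..q}. card ((+) (int (w (2 * i))) ` S))"
  proof (rule card_UN_disjoint)
    show "\<forall>i\<in>{..q}. \<forall>j\<in>{..q}. i \<noteq> j \<longrightarrow> ((+) (int (w (2 * i))) ` S) \<inter> ((+) (int (w (2 * j))) ` S) = {}"
      using disj by (metis atMost_iff inf_commute nat_neq_iff)
  qed (use fin in auto)
  also have "\<dots> = Suc q * card S" by (simp add: card_image)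
  finally have "Suc q * card S = card (\<Union>i\<in>{..q}. (+) (int (w (2 * i))) ` S)" by simp
  also have "\<dots> \<le> card {-L..2 * L}"
  proof (rule card_mono)
    show "(\<Union>i\<in>{..q}. (+) (int (w (2 * i))) ` S) \<subseteq> {-L..2 * L}"
    proof safe
      fix i s assume "i \<le> q" "s \<in> S"
      then show "int (w (2 * i)) + s \<in> {-L..2 * L}" using w2[of "2 * i"] S(2) by force
    qed
  qed simp
  also have "\<dots> = nat (3 * L + 1)" using y by simp
  finally have "int (Suc q * card S) \<le> 3 * L + 1" using y by linarith
  then show False using card by (simp only: of_nat_mult)
qed

text \<open>Translates a walk on rounded values back to the form itself: the differences y - y' of
  the single steps add up coordinatewise, and each step contributes an error of at most 2 in units
  of \<open>\<delta>\<close>.\<close>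

lemma int_walk_floor:
  fixes \<delta> :: real
  assumes "0 < \<delta>" and "h \<in> int_walk {\<lfloor>(\<Sum>i\<in>I. x i * y i) / \<delta>\<rfloor> | y. \<forall>i\<in>I. y i \<in> K} j" and "K \<noteq> {}"
  shows "\<exists>a. (\<forall>i\<in>I. a i \<in> sumprod 1 j K) \<and> \<bar>\<delta> * of_int h - (\<Sum>i\<in>I. x i * a i)\<bar> \<le> 2 * \<delta> * real j"
  using assms(2)
proof (induction j arbitrary: h)
  case 0
  then show ?case using zero_in_sumprod[OF assms(3)] by (intro exI[of _ "\<lambda>_. 0"]) auto
next
  case (Suc j)
  then obtain h' y y' u where h: "h = h' + (\<lfloor>(\<Sum>i\<in>I. x i * y i) / \<delta>\<rfloor> - \<lfloor>(\<Sum>i\<in>I. x i * y' i) / \<delta>\<rfloor>) + u"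
    and h': "h' \<in> int_walk {\<lfloor>(\<Sum>i\<in>I. x i * y i) / \<delta>\<rfloor> | y. \<forall>i\<in>I. y i \<in> K} j"
    and y: "\<forall>i\<in>I. y i \<in> K" "\<forall>i\<in>I. y' i \<in> K" and u: "\<bar>u\<bar> \<le> 1"
    by auto
  obtain a where a: "\<forall>i\<in>I. a i \<in> sumprod 1 j K"
    "\<bar>\<delta> * of_int h' - (\<Sum>i\<in>I. x i * a i)\<bar> \<le> 2 * \<delta> * real j"
    using Suc.IH[OF h'] by blast
  define s where "s = (\<Sum>i\<in>I. x i * y i) / \<delta>"
  define s' where "s' = (\<Sum>i\<in>I. x i * y' i) / \<delta>"
  have "a i + (y i - y' i) \<in> sumprod 1 (Suc j) K" if "i \<in> I" for i
  proof -
    have "y i - y' i \<in> sumprod 1 1 K"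
      using y that by (intro sumprodI) (simp_all add: sumset_1 prodset_1)
    from sumprod_add[OF bspec[OF a(1) that] this] show ?thesis by simp
  qed
  moreover have "\<bar>\<delta> * of_int h - (\<Sum>i\<in>I. x i * (a i + (y i - y' i)))\<bar> \<le> 2 * \<delta> * real (Suc j)"
  proof -
    \<comment> \<open>The difference of the two floors is off by less than 1, and \<open>u\<close>
      adds at most 1.\<close>
    have "\<bar>real_of_int \<lfloor>s\<rfloor> - real_of_int \<lfloor>s'\<rfloor> + real_of_int u - (s - s')\<bar> \<le> 2"
      using u by linarith
    then have "\<delta> * \<bar>real_of_int \<lfloor>s\<rfloor> - real_of_int \<lfloor>s'\<rfloor> + real_of_int u - (s - s')\<bar> \<le> \<delta> * 2"
      using assms(1) by (intro mult_left_mono) auto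
    then have 1: "\<bar>\<delta> * (real_of_int \<lfloor>s\<rfloor> - real_of_int \<lfloor>s'\<rfloor> + real_of_int u - (s - s'))\<bar> \<le> 2 * \<delta>"
      using assms(1) by (simp add: abs_mult)
    have 2: "(\<Sum>i\<in>I. x i * (a i + (y i - y' i))) = (\<Sum>i\<in>I. x i * a i) + (\<delta> * s - \<delta> * s')"
      using assms(1) by (simp add: s_def s'_def algebra_simps sum.distrib sum_subtractf)
    have 3: "\<delta> * of_int h - (\<Sum>i\<in>I. x i * (a i + (y i - y' i))) =
      (\<delta> * of_int h' - (\<Sum>i\<in>I. x i * a i)) +
      \<delta> * (real_of_int \<lfloor>s\<rfloor> - real_of_int \<lfloor>s'\<rfloor> + real_of_int u - (s - s'))"
      unfolding 2 h s_def[symmetric] s'_def[symmetric] by (simp add: algebra_simps)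
    have "\<bar>\<delta> * of_int h - (\<Sum>i\<in>I. x i * (a i + (y i - y' i)))\<bar> \<le> 2 * \<delta> * real j + 2 * \<delta>"
      unfolding 3 by (rule order_trans[OF abs_triangle_ineq add_mono[OF a(2) 1]])
    then show ?thesis by (simp add: distrib_left)
  qed
  ultimately show ?case by (intro exI[of _ "\<lambda>i. a i + (y i - y' i)"] conjI ballI)
qed

subsection \<open>Limits of linear forms\<close>

text \<open>Subsequences are extracted successively, one coordinate at a time.\<close>

lemma convergent_subseq_coordinates:
  fixes f :: "nat \<Rightarrow> 'i \<Rightarrow> 'a::metric_space"
  assumes "finite I" and "compact S" and "\<And>n i. i \<in> I \<Longrightarrow> f n i \<in> S"
  shows "\<exists>l r. strict_mono (r :: nat \<Rightarrow> nat) \<and> (\<forall>i\<in>I. l i \<in> S \<and> (\<lambda>n. f (r n) i) \<longlonglongrightarrow> l i)"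
  using assms(1,3)
proof (induction I)
  case empty
  show ?case using strict_mono_id by auto
next
  case (insert i I)
  then obtain l r where r: "strict_mono (r :: nat \<Rightarrow> nat)"
    and l: "\<forall>j\<in>I. l j \<in> S \<and> (\<lambda>n. f (r n) j) \<longlonglongrightarrow> l j"
    by (metis insertI2)
  have "\<forall>n. f (r n) i \<in> S" using insert.prems by auto
  then obtain l' r' where r': "l' \<in> S" "strict_mono (r' :: nat \<Rightarrow> nat)" "((\<lambda>n. f (r n) i) \<circ> r') \<longlonglongrightarrow> l'"
    using assms(2) unfolding compact_def by metis
  have "(l(i := l')) j \<in> S \<and> (\<lambda>n. f ((r \<circ> r') n) j) \<longlonglongrightarrow> (l(i := l')) j" if "j \<in> insert i I" for j
  proof (cases "j = i")
    case True
    then show ?thesis using r' by (simp add: o_def)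
  next
    case False
    then have "j \<in> I" using that by simp
    then show ?thesis using l False LIMSEQ_subseq_LIMSEQ[OF _ r'(2), of "\<lambda>n. f (r n) j" "l j"]
      by (simp add: o_def)
  qed
  moreover have "strict_mono (r \<circ> r')" using r r'(2) by (rule strict_mono_o)
  ultimately show ?case by blast
qed

text \<open>The subsequence along which the coefficients converge is chosen first and does not
  depend on t, so one limit form serves every t. For each t a further subsequence makes the
  arguments converge within the compact set \<open>A\<close>, and the error tends to 0.\<close>

lemma covers_limit:
  fixes X :: "nat \<Rightarrow> 'i \<Rightarrow> real"
  assumes "finite I" and "compact A" and X: "\<And>n i. i \<in> I \<Longrightarrow> X n i \<in> {0..1}"
    and appr: "\<And>n t. \<bar>t\<bar> \<le> 1 \<Longrightarrow> \<exists>a. (\<forall>i\<in>I. a i \<in> A) \<and> \<bar>t - (\<Sum>i\<in>I. X n i * a i)\<bar> \<le> \<epsilon> n"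
    and \<epsilon>: "\<epsilon> \<longlonglongrightarrow> 0"
  shows "\<exists>x. (\<forall>i\<in>I. x i \<in> {0..1}) \<and> covers I x A"
proof -
  obtain x r where r: "strict_mono (r :: nat \<Rightarrow> nat)"
    and x: "\<forall>i\<in>I. x i \<in> {0..1} \<and> (\<lambda>n. X (r n) i) \<longlonglongrightarrow> x i"
    using convergent_subseq_coordinates[where f = X, OF assms(1) compact_Icc X] by blast
  have "\<exists>a. (\<forall>i\<in>I. a i \<in> A) \<and> (\<Sum>i\<in>I. x i * a i) = t" if "\<bar>t\<bar> \<le> 1" for t
  proof -
    have "\<forall>n. \<exists>a. (\<forall>i\<in>I. a i \<in> A) \<and> \<bar>t - (\<Sum>i\<in>I. X n i * a i)\<bar> \<le> \<epsilon> n"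
      using appr[OF that] by blast
    from choice[OF this] obtain a
      where a: "\<forall>n. (\<forall>i\<in>I. a n i \<in> A) \<and> \<bar>t - (\<Sum>i\<in>I. X n i * a n i)\<bar> \<le> \<epsilon> n" ..
    obtain l r' where r': "strict_mono (r' :: nat \<Rightarrow> nat)"
      and l: "\<forall>i\<in>I. l i \<in> A \<and> (\<lambda>n. a (r (r' n)) i) \<longlonglongrightarrow> l i"
      using convergent_subseq_coordinates[OF assms(1,2), of "\<lambda>n. a (r n)"] a by blast
    have 1: "(\<lambda>n. t - (\<Sum>i\<in>I. X (r (r' n)) i * a (r (r' n)) i)) \<longlonglongrightarrow> t - (\<Sum>i\<in>I. x i * l i)"
    proof (intro tendsto_intros)
      fix i assume i: "i \<in> I"
      show "(\<lambda>n. X (r (r' n)) i) \<longlonglongrightarrow> x i"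
        using LIMSEQ_subseq_LIMSEQ[OF conjunct2[OF bspec[OF x i]] r'] by (simp add: o_def)
      show "(\<lambda>n. a (r (r' n)) i) \<longlonglongrightarrow> l i"
        using l i by blast
    qed
    have "strict_mono (r \<circ> r')" using r r' by (rule strict_mono_o)
    from LIMSEQ_subseq_LIMSEQ[OF \<epsilon> this]
    have 2: "(\<lambda>n. \<epsilon> (r (r' n))) \<longlonglongrightarrow> 0" by (simp add: o_def)
    have "(\<lambda>n. t - (\<Sum>i\<in>I. X (r (r' n)) i * a (r (r' n)) i)) \<longlonglongrightarrow> 0"
      by (rule Lim_null_comparison[OF _ 2]) (use a in auto)
    from LIMSEQ_unique[OF 1 this] l show ?thesis by (intro exI[of _ l]) auto
  qed
  then show ?thesis using x unfolding covers_def by blast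
qed

subsection \<open>Energy of a random linear form\<close>

abbreviation unit_lborel :: "real measure" where
  "unit_lborel \<equiv> restrict_space lborel {0..1}"

lemma prob_space_unit_lborel: "prob_space unit_lborel"
  by (rule prob_spaceI) (simp add: emeasure_restrict_space space_restrict_space)

lemma id_measurable_unit_lborel: "(\<lambda>x. x) \<in> borel_measurable unit_lborel"
  by (rule measurable_restrict_space1) simp

lemma component_measurable_unit_lborel [measurable]:
  "j \<in> I \<Longrightarrow> (\<lambda>x. x j) \<in> borel_measurable (PiM I (\<lambda>_. unit_lborel))"
  using measurable_compose[OF measurable_component_singleton[of j I "\<lambda>_. unit_lborel"] id_measurable_unit_lborel]
  by simp

text \<open>With all coefficients but the i-th fixed, the condition confines x_i to an interval of
  length 2 delta / |v_i| centred at -s / v_i, where s is the contribution of the other coordinates.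
  Fubini then gives the bound.\<close>

lemma emeasure_small_form_coordinate:
  fixes v :: "'i \<Rightarrow> real"
  assumes "finite I" and i: "i \<in> I" "v i \<noteq> 0" and "0 \<le> \<delta>"
  shows "emeasure (PiM I (\<lambda>_. unit_lborel)) {x \<in> space (PiM I (\<lambda>_. unit_lborel)). \<bar>\<Sum>j\<in>I. x j * v j\<bar> \<le> \<delta>}
    \<le> ennreal (2 * \<delta> / \<bar>v i\<bar>)" (is "emeasure ?V ?A \<le> _")
proof -
  interpret product_prob_space "\<lambda>_. unit_lborel" UNIV
    by (rule product_prob_spaceI) (rule prob_space_unit_lborel)
  define I' where "I' = I - {i}"
  have I: "insert i I' = I" "i \<notin> I'" "finite I'" using i \<open>finite I\<close> by (auto simp: I'_def)
  interpret V': prob_space "PiM I' (\<lambda>_. unit_lborel)"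
    by (intro prob_space_PiM prob_space_unit_lborel)
  have A: "?A \<in> sets ?V" by measurable
  have "emeasure ?V ?A = (\<integral>\<^sup>+x. indicator ?A x \<partial>?V)" using A by simp
  also have "\<dots> = (\<integral>\<^sup>+x. (\<integral>\<^sup>+y. indicator ?A (x(i := y)) \<partial>unit_lborel) \<partial>(PiM I' (\<lambda>_. unit_lborel)))"
    using product_nn_integral_insert[OF I(3,2), of "indicator ?A"] A by (simp add: I(1))
  also have "\<dots> \<le> (\<integral>\<^sup>+x. ennreal (2 * \<delta> / \<bar>v i\<bar>) \<partial>(PiM I' (\<lambda>_. unit_lborel)))"
  proof (rule nn_integral_mono)
    fix x
    define s where "s = (\<Sum>j\<in>I'. x j * v j)"
    have "(\<integral>\<^sup>+y. indicator ?A (x(i := y)) \<partial>unit_lborel)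
        = (\<integral>\<^sup>+y. indicator ?A (x(i := y)) * indicator {0..1} y \<partial>lborel)"
      by (rule nn_integral_restrict_space) simp
    also have "\<dots> \<le> (\<integral>\<^sup>+y. indicator {- s / v i - \<delta> / \<bar>v i\<bar> .. - s / v i + \<delta> / \<bar>v i\<bar>} y \<partial>lborel)"
    proof (rule nn_integral_mono)
      fix y
      have "\<bar>y - (- s / v i)\<bar> \<le> \<delta> / \<bar>v i\<bar>" if "x(i := y) \<in> ?A"
      proof -
        have "(\<Sum>j\<in>I. (x(i := y)) j * v j) = y * v i + s"
          using I unfolding s_def I(1)[symmetric]
          by (subst sum.insert) (auto intro!: sum.cong)
        then have "\<bar>y * v i + s\<bar> \<le> \<delta>" using that by simp
        moreover have "y * v i + s = (y - (- s / v i)) * v i" using i by (simp add: field_simps)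
        ultimately show ?thesis using i by (simp add: abs_mult pos_le_divide_eq)
      qed
      then show "(indicator ?A (x(i := y)) * indicator {0..1} y :: ennreal)
          \<le> indicator {- s / v i - \<delta> / \<bar>v i\<bar> .. - s / v i + \<delta> / \<bar>v i\<bar>} y"
        by (auto simp: indicator_def abs_le_iff)
    qed
    also have "\<dots> = ennreal (2 * \<delta> / \<bar>v i\<bar>)"
      using \<open>0 \<le> \<delta>\<close> by simp
    finally show "(\<integral>\<^sup>+y. indicator ?A (x(i := y)) \<partial>unit_lborel) \<le> ennreal (2 * \<delta> / \<bar>v i\<bar>)" .
  qed
  also have "\<dots> = ennreal (2 * \<delta> / \<bar>v i\<bar>)" by (simp add: V'.emeasure_space_1)
  finally show ?thesis .
qed

text \<open>The coordinate bound sorted by the size of \<open>v\<close>. If some coordinate exceeds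
  1, the first term suffices; if all are at most 1 / 2^J, the term j = J exceeds the trivial bound
  1; otherwise some j < J has all coordinates at most 1 / 2^j and one above 1 / 2^(j+1). Indicators
  replace 1 / |v| so that integration over differences y - y' only involves measures of
  balls.\<close>

lemma emeasure_small_form_dyadic:
  fixes v :: "'i \<Rightarrow> real"
  assumes "finite I"
  shows "emeasure (PiM I (\<lambda>_. unit_lborel)) {x \<in> space (PiM I (\<lambda>_. unit_lborel)). \<bar>\<Sum>j\<in>I. x j * v j\<bar> \<le> 1 / 2 ^ J}
    \<le> ennreal (2 / 2 ^ J) + (\<Sum>j\<le>J. ennreal (4 * 2 ^ j / 2 ^ J) * indicator {v. \<forall>i\<in>I. \<bar>v i\<bar> \<le> 1 / 2 ^ j} v)"
    (is "emeasure ?V ?A \<le> _ + ?S")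
proof -
  interpret V: prob_space ?V
    by (intro prob_space_PiM prob_space_unit_lborel)
  define P where "P j \<longleftrightarrow> (\<forall>i\<in>I. \<bar>v i\<bar> \<le> 1 / 2 ^ j)" for j :: nat
  have leS: "ennreal (4 * 2 ^ j / 2 ^ J) \<le> ?S" if "P j" "j \<le> J" for j
  proof -
    have "ennreal (4 * 2 ^ j / 2 ^ J) = ennreal (4 * 2 ^ j / 2 ^ J) * indicator {v. \<forall>i\<in>I. \<bar>v i\<bar> \<le> 1 / 2 ^ j} v"
      using that by (simp add: P_def)
    also have "\<dots> \<le> ?S" using that by (intro member_le_sum) auto
    finally show ?thesis .
  qed
  consider "\<not> P 0" | "P J" | "P 0" "\<not> P J" by blast
  then show ?thesis
  proof cases
    case 1
    then obtain i where i: "i \<in> I" "1 < \<bar>v i\<bar>" by (auto simp: P_def not_le)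
    have "emeasure ?V ?A \<le> ennreal (2 * (1 / 2 ^ J) / \<bar>v i\<bar>)"
      using i by (intro emeasure_small_form_coordinate assms) auto
    also have "\<dots> \<le> ennreal (2 / 2 ^ J)"
      using i by (intro ennreal_leI) (simp add: divide_le_eq)
    finally show ?thesis by (rule order_trans) simp
  next
    case 2
    have "emeasure ?V ?A \<le> ennreal 1" using V.emeasure_le_1 by simp
    also have "\<dots> \<le> ennreal (4 * 2 ^ J / 2 ^ J)" by (intro ennreal_leI) simp
    also have "\<dots> \<le> ?S" using leS[OF 2] by simp
    finally show ?thesis by (rule order_trans) simp
  next
    case 3
    then have "\<exists>j<J. P j \<and> \<not> P (Suc j)"
    proof (induction J)
      case (Suc J)
      then show ?case by (cases "P J") (auto intro: less_SucI)
    qed auto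
    then obtain j where j: "j < J" "P j" "\<not> P (Suc j)" by blast
    then obtain i where i: "i \<in> I" "1 / 2 ^ Suc j < \<bar>v i\<bar>" by (auto simp: P_def not_le)
    then have pos: "0 < \<bar>v i\<bar>" by (meson less_trans zero_less_divide_1_iff zero_less_numeral zero_less_power)
    have "emeasure ?V ?A \<le> ennreal (2 * (1 / 2 ^ J) / \<bar>v i\<bar>)"
      using i pos by (intro emeasure_small_form_coordinate assms) auto
    also have "\<dots> \<le> ennreal (4 * 2 ^ j / 2 ^ J)"
    proof (rule ennreal_leI)
      have "1 / \<bar>v i\<bar> \<le> 2 ^ Suc j" using i(2) pos by (simp add: field_simps)
      then have "(2 / 2 ^ J) * (1 / \<bar>v i\<bar>) \<le> (2 / 2 ^ J) * 2 ^ Suc j" by (intro mult_left_mono) auto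
      then show "2 * (1 / 2 ^ J) / \<bar>v i\<bar> \<le> 4 * 2 ^ j / 2 ^ J" by simp
    qed
    also have "\<dots> \<le> ?S" using leS[of j] j by simp
    finally show ?thesis by (rule order_trans) simp
  qed
qed

lemma sum_half_powers_le: "(\<Sum>j\<le>J. 1 / 2 ^ j) \<le> (2 :: real)"
proof -
  have "(\<Sum>j\<le>J. 1 / 2 ^ j) = 2 - 1 / (2 :: real) ^ J"
    by (induction J) (auto simp: field_simps)
  then show ?thesis by simp
qed

text \<open>Integrated over y', the j-th indicator of the dyadic bound becomes a product of ball
  measures, at most B / 4^j. This beats the weight 4 * 2^j / 2^J and leaves a geometric series with
  sum at most 8 B / 2^J.\<close>

lemma nn_integral_small_form_le:
  fixes \<mu> :: "real measure"
  assumes "prob_space \<mu>" and sets: "sets \<mu> = sets borel" and "finite I" and "0 \<le> B"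
    and small: "\<And>y j. (\<Prod>i\<in>I. measure \<mu> (cball (y i) (1 / 2 ^ j))) \<le> B / 4 ^ j"
  shows "(\<integral>\<^sup>+y'. emeasure (PiM I (\<lambda>_. unit_lborel))
      {x \<in> space (PiM I (\<lambda>_. unit_lborel)). \<bar>\<Sum>j\<in>I. x j * (y j - y' j)\<bar> \<le> 1 / 2 ^ J} \<partial>(PiM I (\<lambda>_. \<mu>)))
    \<le> ennreal ((2 + 8 * B) / 2 ^ J)"
proof -
  interpret \<mu>: prob_space \<mu> by fact
  interpret product_prob_space "\<lambda>_. \<mu>" UNIV
    by (rule product_prob_spaceI) (rule \<open>prob_space \<mu>\<close>)
  define P where "P = PiM I (\<lambda>_. \<mu>)"
  interpret PP: prob_space P unfolding P_def by (intro prob_space_PiM \<open>prob_space \<mu>\<close>)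
  define T where "T j = PiE I (\<lambda>i. cball (y i) (1 / 2 ^ j))" for j :: nat
  have Ts: "T j \<in> sets P" for j
    unfolding T_def P_def using \<open>finite I\<close> by (intro sets_PiM_I_finite) (auto simp: sets)
  have eT: "emeasure P (T j) \<le> ennreal (B / 4 ^ j)" for j
  proof -
    have "emeasure P (T j) = (\<Prod>i\<in>I. emeasure \<mu> (cball (y i) (1 / 2 ^ j)))"
      unfolding T_def P_def using \<open>finite I\<close> by (intro emeasure_PiM) (auto simp: sets)
    also have "\<dots> = ennreal (\<Prod>i\<in>I. measure \<mu> (cball (y i) (1 / 2 ^ j)))"
      by (simp add: \<mu>.emeasure_eq_measure prod_ennreal)
    finally show ?thesis using small by (simp add: ennreal_leI)
  qed
  have "(\<integral>\<^sup>+y'. emeasure (PiM I (\<lambda>_. unit_lborel))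
      {x \<in> space (PiM I (\<lambda>_. unit_lborel)). \<bar>\<Sum>j\<in>I. x j * (y j - y' j)\<bar> \<le> 1 / 2 ^ J} \<partial>P)
    \<le> (\<integral>\<^sup>+y'. ennreal (2 / 2 ^ J) + (\<Sum>j\<le>J. ennreal (4 * 2 ^ j / 2 ^ J) * indicator (T j) y') \<partial>P)"
  proof (rule nn_integral_mono)
    fix y' assume y': "y' \<in> space P"
    have "(indicator {v. \<forall>i\<in>I. \<bar>v i\<bar> \<le> 1 / 2 ^ j} (\<lambda>i. y i - y' i) :: ennreal) = indicator (T j) y'" for j :: nat
      using y' by (auto simp: indicator_def T_def P_def space_PiM PiE_iff dist_real_def)
    then show "emeasure (PiM I (\<lambda>_. unit_lborel))
      {x \<in> space (PiM I (\<lambda>_. unit_lborel)). \<bar>\<Sum>j\<in>I. x j * (y j - y' j)\<bar> \<le> 1 / 2 ^ J}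
      \<le> ennreal (2 / 2 ^ J) + (\<Sum>j\<le>J. ennreal (4 * 2 ^ j / 2 ^ J) * indicator (T j) y')"
      using emeasure_small_form_dyadic[OF \<open>finite I\<close>, of "\<lambda>i. y i - y' i" J] by simp
  qed
  also have "\<dots> = ennreal (2 / 2 ^ J) + (\<Sum>j\<le>J. ennreal (4 * 2 ^ j / 2 ^ J) * emeasure P (T j))"
  proof -
    have [measurable]: "T j \<in> sets P" for j by (rule Ts)
    have "(\<integral>\<^sup>+y'. (\<Sum>j\<le>J. ennreal (4 * 2 ^ j / 2 ^ J) * indicator (T j) y') \<partial>P)
      = (\<Sum>j\<le>J. \<integral>\<^sup>+y'. ennreal (4 * 2 ^ j / 2 ^ J) * indicator (T j) y' \<partial>P)"
      by (rule nn_integral_sum) measurable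
    also have "\<dots> = (\<Sum>j\<le>J. ennreal (4 * 2 ^ j / 2 ^ J) * emeasure P (T j))"
      by (intro sum.cong refl nn_integral_cmult_indicator Ts)
    finally show ?thesis
      by (subst nn_integral_add) (measurable, simp only: nn_integral_const PP.emeasure_space_1 mult_1_right)
  qed
  also have "\<dots> \<le> ennreal (2 / 2 ^ J) + (\<Sum>j\<le>J. ennreal (4 * 2 ^ j / 2 ^ J) * ennreal (B / 4 ^ j))"
    by (intro add_left_mono sum_mono mult_left_mono eT) auto
  also have "\<dots> = ennreal (2 / 2 ^ J) + (\<Sum>j\<le>J. ennreal (4 * B / 2 ^ J * (1 / 2 ^ j)))"
  proof -
    have "(4 :: real) ^ j = 2 ^ j * 2 ^ j" for j
      using power_mult_distrib[of "2 :: real" 2 j] by simp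
    then have eq: "(4 * 2 ^ j / 2 ^ J) * (B / 4 ^ j) = 4 * B / 2 ^ J * (1 / 2 ^ j)" for j
      by simp
    have "ennreal (4 * 2 ^ j / 2 ^ J) * ennreal (B / 4 ^ j) = ennreal (4 * B / 2 ^ J * (1 / 2 ^ j))" for j
      unfolding eq[symmetric] by (rule ennreal_mult'[symmetric]) simp
    then show ?thesis by simp
  qed
  also have "\<dots> = ennreal (2 / 2 ^ J + 4 * B / 2 ^ J * (\<Sum>j\<le>J. 1 / 2 ^ j))"
    using \<open>0 \<le> B\<close> by (simp add: sum_distrib_left sum_nonneg)
  also have "\<dots> \<le> ennreal ((2 + 8 * B) / 2 ^ J)"
  proof (rule ennreal_leI)
    have "4 * B / 2 ^ J * (\<Sum>j\<le>J. 1 / 2 ^ j) \<le> 4 * B / 2 ^ J * 2"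
      using sum_half_powers_le[of J] \<open>0 \<le> B\<close> by (intro mult_left_mono) auto
    then show "2 / 2 ^ J + 4 * B / 2 ^ J * (\<Sum>j\<le>J. 1 / 2 ^ j) \<le> (2 + 8 * B) / 2 ^ J"
      by (simp add: add_divide_distrib)
  qed
  finally show ?thesis unfolding P_def .
qed

text \<open>The three vectors are arbitrary functions of \<open>z\<close>, so that one statement
  covers both interchanges of integrals in the averaging argument, over a triple product and over a
  double product with y fixed.\<close>

lemma borel_measurable_indicator_form:
  fixes X Y Y' :: "'z \<Rightarrow> 'i \<Rightarrow> real"
  assumes "\<And>j. j \<in> I \<Longrightarrow> (\<lambda>z. X z j) \<in> borel_measurable M"
    and "\<And>j. j \<in> I \<Longrightarrow> (\<lambda>z. Y z j) \<in> borel_measurable M"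
    and "\<And>j. j \<in> I \<Longrightarrow> (\<lambda>z. Y' z j) \<in> borel_measurable M"
  shows "(\<lambda>z. indicator {a..b} (\<Sum>j\<in>I. X z j * (Y z j - Y' z j)) :: ennreal) \<in> borel_measurable M"
proof -
  define f where "f z = (\<Sum>j\<in>I. X z j * (Y z j - Y' z j))" for z
  have "f \<in> borel_measurable M"
    unfolding f_def by (intro borel_measurable_sum borel_measurable_times borel_measurable_diff assms)
  have "(indicator {a..b} :: real \<Rightarrow> ennreal) \<in> borel_measurable borel"
    by (rule borel_measurable_indicator) simp
  then have "(\<lambda>z. indicator {a..b} (f z) :: ennreal) \<in> borel_measurable M"
    by (rule measurable_compose[OF \<open>f \<in> borel_measurable M\<close>])
  then show ?thesis by (simp only: f_def)
qed

lemma component_borel_measurable_PiM: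
  assumes "sets \<mu> = sets borel" and "j \<in> I"
  shows "(\<lambda>x. x j) \<in> borel_measurable (PiM I (\<lambda>_. \<mu>))"
  using measurable_component_singleton[OF assms(2), of "\<lambda>_. \<mu>"] measurable_cong_sets[OF refl assms(1)]
  by blast

text \<open>Averaging over coefficients uniform in [0,1]: after moving the integral over x to the
  inside, the mean energy is at most (2 + 8 B) / 2^J, so not every x can have energy above the
  stated bound.\<close>

lemma exists_form_small_energy:
  fixes \<mu> :: "real measure"
  assumes "prob_space \<mu>" and sets: "sets \<mu> = sets borel" and "finite I" and "0 \<le> B"
    and small: "\<And>y j. (\<Prod>i\<in>I. measure \<mu> (cball (y i) (1 / 2 ^ j))) \<le> B / 4 ^ j"
  shows "\<exists>x. (\<forall>i\<in>I. x i \<in> {0..1}) \<and>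
    (\<integral>\<^sup>+y. (\<integral>\<^sup>+y'. indicator {-(1 / 2 ^ J)..1 / 2 ^ J} (\<Sum>j\<in>I. x j * (y j - y' j)) \<partial>PiM I (\<lambda>_. \<mu>)) \<partial>PiM I (\<lambda>_. \<mu>))
    \<le> ennreal ((3 + 8 * B) / 2 ^ J)"
proof (rule ccontr)
  define V :: "('a \<Rightarrow> real) measure" where "V = PiM I (\<lambda>_. unit_lborel)"
  define P where "P = PiM I (\<lambda>_. \<mu>)"
  define g :: "('a \<Rightarrow> real) \<Rightarrow> ('a \<Rightarrow> real) \<Rightarrow> ('a \<Rightarrow> real) \<Rightarrow> ennreal"
    where "g x y y' = indicator {-(1 / 2 ^ J)..1 / 2 ^ J} (\<Sum>j\<in>I. x j * (y j - y' j))" for x y y'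
  interpret V: prob_space V unfolding V_def by (intro prob_space_PiM prob_space_unit_lborel)
  interpret PP: prob_space P unfolding P_def by (intro prob_space_PiM \<open>prob_space \<mu>\<close>)
  interpret VP: pair_sigma_finite V P by standard
  have mV: "(\<lambda>x. x j) \<in> borel_measurable V" if "j \<in> I" for j
    unfolding V_def by (rule component_measurable_unit_lborel[OF that])
  have mP: "(\<lambda>x. x j) \<in> borel_measurable P" if "j \<in> I" for j
    unfolding P_def by (rule component_borel_measurable_PiM[OF sets that])
  assume neg: "\<not> ?thesis"
  \<comment> \<open>A weak inequality is enough here: the gap between the constants 3 and 2 produces
    the contradiction after integration.\<close>
  have lt: "ennreal ((3 + 8 * B) / 2 ^ J) \<le> (\<integral>\<^sup>+y. (\<integral>\<^sup>+y'. g x y y' \<partial>P) \<partial>P)" if "x \<in> space V" for x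
  proof -
    have "\<forall>i\<in>I. x i \<in> {0..1}"
      using that by (simp add: V_def space_PiM PiE_iff space_restrict_space)
    with neg have "\<not> (\<integral>\<^sup>+y. (\<integral>\<^sup>+y'. g x y y' \<partial>P) \<partial>P) \<le> ennreal ((3 + 8 * B) / 2 ^ J)"
      unfolding g_def P_def by blast
    then show ?thesis by (simp only: not_le less_imp_le)
  qed
  have gm: "(\<lambda>(x, y). \<integral>\<^sup>+y'. g x y y' \<partial>P) \<in> borel_measurable (V \<Otimes>\<^sub>M P)"
    unfolding split_def g_def
  proof (rule PP.borel_measurable_nn_integral, unfold split_def, rule borel_measurable_indicator_form)
    fix j assume j: "j \<in> I"
    note f = measurable_compose[OF measurable_fst]
    show "(\<lambda>z. fst (fst z) j) \<in> borel_measurable ((V \<Otimes>\<^sub>M P) \<Otimes>\<^sub>M P)"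
      by (rule f[OF f[OF mV[OF j]]])
    show "(\<lambda>z. snd (fst z) j) \<in> borel_measurable ((V \<Otimes>\<^sub>M P) \<Otimes>\<^sub>M P)"
      by (rule f[OF measurable_compose[OF measurable_snd mP[OF j]]])
    show "(\<lambda>z. snd z j) \<in> borel_measurable ((V \<Otimes>\<^sub>M P) \<Otimes>\<^sub>M P)"
      by (rule measurable_compose[OF measurable_snd mP[OF j]])
  qed
  have gm': "(\<lambda>(x, y'). g x y y') \<in> borel_measurable (V \<Otimes>\<^sub>M P)" for y
    unfolding split_def g_def
  proof (rule borel_measurable_indicator_form)
    fix j assume j: "j \<in> I"
    show "(\<lambda>z. fst z j) \<in> borel_measurable (V \<Otimes>\<^sub>M P)"
      by (rule measurable_compose[OF measurable_fst mV[OF j]])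
    show "(\<lambda>z. snd z j) \<in> borel_measurable (V \<Otimes>\<^sub>M P)"
      by (rule measurable_compose[OF measurable_snd mP[OF j]])
  qed simp
  have "ennreal ((3 + 8 * B) / 2 ^ J) = (\<integral>\<^sup>+x. ennreal ((3 + 8 * B) / 2 ^ J) \<partial>V)"
    by (simp add: V.emeasure_space_1)
  also have "\<dots> \<le> (\<integral>\<^sup>+x. (\<integral>\<^sup>+y. (\<integral>\<^sup>+y'. g x y y' \<partial>P) \<partial>P) \<partial>V)"
    by (intro nn_integral_mono lt)
  also have "\<dots> = (\<integral>\<^sup>+y. (\<integral>\<^sup>+x. (\<integral>\<^sup>+y'. g x y y' \<partial>P) \<partial>V) \<partial>P)"
    by (rule VP.Fubini'[OF gm, symmetric])
  also have "\<dots> = (\<integral>\<^sup>+y. (\<integral>\<^sup>+y'. (\<integral>\<^sup>+x. g x y y' \<partial>V) \<partial>P) \<partial>P)"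
  proof (rule nn_integral_cong)
    fix y
    show "(\<integral>\<^sup>+x. (\<integral>\<^sup>+y'. g x y y' \<partial>P) \<partial>V) = (\<integral>\<^sup>+y'. (\<integral>\<^sup>+x. g x y y' \<partial>V) \<partial>P)"
      by (rule VP.Fubini'[OF gm', symmetric])
  qed
  also have "\<dots> \<le> (\<integral>\<^sup>+y. ennreal ((2 + 8 * B) / 2 ^ J) \<partial>P)"
  proof (rule nn_integral_mono)
    fix y
    have "(\<integral>\<^sup>+x. g x y y' \<partial>V) = emeasure V {x \<in> space V. \<bar>\<Sum>j\<in>I. x j * (y j - y' j)\<bar> \<le> 1 / 2 ^ J}" for y'
    proof -
      have "(\<integral>\<^sup>+x. g x y y' \<partial>V)
          = (\<integral>\<^sup>+x. indicator {x \<in> space V. \<bar>\<Sum>j\<in>I. x j * (y j - y' j)\<bar> \<le> 1 / 2 ^ J} x \<partial>V)"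
        by (intro nn_integral_cong) (auto simp: g_def indicator_def abs_le_iff)
      also have "\<dots> = emeasure V {x \<in> space V. \<bar>\<Sum>j\<in>I. x j * (y j - y' j)\<bar> \<le> 1 / 2 ^ J}"
        unfolding V_def by (rule nn_integral_indicator) measurable
      finally show ?thesis .
    qed
    then show "(\<integral>\<^sup>+y'. (\<integral>\<^sup>+x. g x y y' \<partial>V) \<partial>P) \<le> ennreal ((2 + 8 * B) / 2 ^ J)"
      using nn_integral_small_form_le[OF assms, of y J] by (simp add: V_def P_def)
  qed
  also have "\<dots> = ennreal ((2 + 8 * B) / 2 ^ J)" by (simp add: PP.emeasure_space_1)
  finally have "(3 + 8 * B) / 2 ^ J \<le> (2 + 8 * B) / 2 ^ J"
    using \<open>0 \<le> B\<close> by (subst (asm) ennreal_le_iff) auto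
  then show False by (simp add: divide_le_cancel)
qed

text \<open>Cauchy-Schwarz: the masses of the cells indexed by \<open>S\<close> sum to at least 1,
  so 1 is at most \<open>card S\<close> times the sum of their squares. That sum is the probability
  that two independent points fall into the same cell, and then the values of the form differ by at
  most \<open>\<delta>\<close>.\<close>

lemma card_ge_of_small_energy:
  fixes \<mu> :: "real measure" and x :: "'i \<Rightarrow> real"
  assumes "prob_space \<mu>" and sets: "sets \<mu> = sets borel" and "finite I"
    and K: "K \<in> sets borel" "measure \<mu> K = 1" and "0 < \<delta>" "0 \<le> A"
    and energy: "(\<integral>\<^sup>+y. (\<integral>\<^sup>+y'. indicator {-\<delta>..\<delta>} (\<Sum>j\<in>I. x j * (y j - y' j)) \<partial>PiM I (\<lambda>_. \<mu>)) \<partial>PiM I (\<lambda>_. \<mu>))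
      \<le> ennreal A"
    and "finite S" and S: "\<And>y. (\<forall>i\<in>I. y i \<in> K) \<Longrightarrow> \<lfloor>(\<Sum>i\<in>I. x i * y i) / \<delta>\<rfloor> \<in> S"
  shows "1 \<le> A * card S"
proof -
  interpret \<mu>: prob_space \<mu> by fact
  interpret product_prob_space "\<lambda>_. \<mu>" UNIV
    by (rule product_prob_spaceI) (rule \<open>prob_space \<mu>\<close>)
  define P where "P = PiM I (\<lambda>_. \<mu>)"
  interpret PP: prob_space P unfolding P_def by (intro prob_space_PiM \<open>prob_space \<mu>\<close>)
  have F: "(\<lambda>y. (\<Sum>i\<in>I. x i * y i) / \<delta>) \<in> borel_measurable P"
    unfolding P_def
    by (intro borel_measurable_divide borel_measurable_sum borel_measurable_times borel_measurable_const
        component_borel_measurable_PiM sets)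
  define G where "G n = {y \<in> space P. \<lfloor>(\<Sum>i\<in>I. x i * y i) / \<delta>\<rfloor> = n}" for n
  have G[measurable]: "G n \<in> sets P" for n
  proof -
    have "G n = (\<lambda>y. (\<Sum>i\<in>I. x i * y i) / \<delta>) -` {of_int n..<of_int n + 1} \<inter> space P"
      by (auto simp: G_def floor_eq_iff)
    moreover have "\<dots> \<in> sets P" by (rule measurable_sets[OF F]) simp
    ultimately show ?thesis by (simp only:)
  qed
  have "measure P (PiE I (\<lambda>_. K)) = 1"
  proof -
    have "emeasure P (PiE I (\<lambda>_. K)) = (\<Prod>i\<in>I. emeasure \<mu> K)"
      unfolding P_def using \<open>finite I\<close> K by (intro emeasure_PiM) (auto simp: sets)
    also have "emeasure \<mu> K = 1" by (simp add: \<mu>.emeasure_eq_measure K(2))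
    finally show ?thesis by (simp add: measure_def)
  qed
  moreover have "measure P (PiE I (\<lambda>_. K)) \<le> measure P (\<Union>n\<in>S. G n)"
  proof (rule PP.finite_measure_mono)
    have "space \<mu> = UNIV" using sets_eq_imp_space_eq[OF sets] by simp
    then show "PiE I (\<lambda>_. K) \<subseteq> (\<Union>n\<in>S. G n)"
      using S unfolding G_def P_def by (auto simp: space_PiM PiE_iff)
  qed (use \<open>finite S\<close> in \<open>intro sets.finite_UN G\<close>)
  moreover have "measure P (\<Union>n\<in>S. G n) \<le> (\<Sum>n\<in>S. measure P (G n))"
    using \<open>finite S\<close> by (intro PP.finite_measure_subadditive_finite) auto
  ultimately have "1 \<le> (\<Sum>n\<in>S. measure P (G n))" by simp
  then have "1 \<le> (\<Sum>n\<in>S. measure P (G n))\<^sup>2" by (rule one_le_power)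
  also have "\<dots> \<le> (\<Sum>n\<in>S. (measure P (G n))\<^sup>2) * card S" by (rule sum_squared_le_sum_of_squares)
  also have "\<dots> \<le> A * card S"
  proof (rule mult_right_mono)
    have "ennreal (\<Sum>n\<in>S. (measure P (G n))\<^sup>2) = (\<Sum>n\<in>S. emeasure P (G n) * emeasure P (G n))"
      by (simp add: PP.emeasure_eq_measure ennreal_mult'[symmetric] power2_eq_square)
    also have "\<dots> = (\<Sum>n\<in>S. \<integral>\<^sup>+y. indicator (G n) y * emeasure P (G n) \<partial>P)"
      by (intro sum.cong refl) (simp add: nn_integral_multc)
    also have "\<dots> = (\<Sum>n\<in>S. \<integral>\<^sup>+y. \<integral>\<^sup>+y'. indicator (G n) y * indicator (G n) y' \<partial>P \<partial>P)"
      by (simp add: nn_integral_cmult)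
    also have "\<dots> = (\<integral>\<^sup>+y. (\<Sum>n\<in>S. \<integral>\<^sup>+y'. indicator (G n) y * indicator (G n) y' \<partial>P) \<partial>P)"
      by (rule nn_integral_sum[symmetric]) (simp add: nn_integral_cmult)
    also have "\<dots> = (\<integral>\<^sup>+y. \<integral>\<^sup>+y'. (\<Sum>n\<in>S. indicator (G n) y * indicator (G n) y') \<partial>P \<partial>P)"
      by (intro nn_integral_cong nn_integral_sum[symmetric]) measurable
    also have "\<dots> \<le> (\<integral>\<^sup>+y. \<integral>\<^sup>+y'. indicator {-\<delta>..\<delta>} (\<Sum>j\<in>I. x j * (y j - y' j)) \<partial>P \<partial>P)"
    proof (intro nn_integral_mono)
      fix y y' assume "y \<in> space P" "y' \<in> space P"
      define s where "s = (\<Sum>i\<in>I. x i * y i) / \<delta>"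
      define s' where "s' = (\<Sum>i\<in>I. x i * y' i) / \<delta>"
      \<comment> \<open>Only the cell of \<open>y\<close> can contribute, and it does so only if
        \<open>y'\<close> lies in it too.\<close>
      have "(\<Sum>n\<in>S. indicator (G n) y * indicator (G n) y' :: ennreal)
        = (\<Sum>n\<in>S. if n = \<lfloor>s\<rfloor> then (if \<lfloor>s'\<rfloor> = \<lfloor>s\<rfloor> then 1 else 0) else 0)"
        using \<open>y \<in> space P\<close> \<open>y' \<in> space P\<close>
        by (intro sum.cong refl) (auto simp: G_def s_def s'_def indicator_def)
      also have "\<dots> \<le> (if \<lfloor>s'\<rfloor> = \<lfloor>s\<rfloor> then 1 else 0)" using \<open>finite S\<close> by simp
      also have "\<dots> \<le> indicator {-\<delta>..\<delta>} (\<Sum>j\<in>I. x j * (y j - y' j))"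
      proof (cases "\<lfloor>s'\<rfloor> = \<lfloor>s\<rfloor>")
        case True
        then have "\<bar>s - s'\<bar> \<le> 1" by linarith
        then have "\<delta> * \<bar>s - s'\<bar> \<le> \<delta> * 1" using \<open>0 < \<delta>\<close> by (intro mult_left_mono) auto
        moreover have "(\<Sum>j\<in>I. x j * (y j - y' j)) = \<delta> * (s - s')"
          using \<open>0 < \<delta>\<close> by (simp add: s_def s'_def right_diff_distrib sum_subtractf)
        ultimately have "\<bar>\<Sum>j\<in>I. x j * (y j - y' j)\<bar> \<le> \<delta>"
          using \<open>0 < \<delta>\<close> by (simp add: abs_mult)
        then show ?thesis by (simp add: abs_le_iff indicator_def)
      qed simp
      finally show "(\<Sum>n\<in>S. indicator (G n) y * indicator (G n) y')
          \<le> (indicator {-\<delta>..\<delta>} (\<Sum>j\<in>I. x j * (y j - y' j)) :: ennreal)" .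
    qed
    also have "\<dots> \<le> ennreal A" using energy by (simp add: P_def)
    finally show "(\<Sum>n\<in>S. (measure P (G n))\<^sup>2) \<le> A"
      using \<open>0 \<le> A\<close> by (simp add: ennreal_le_iff)
  qed simp
  finally show ?thesis .
qed

subsection \<open>Frostman measures\<close>

lemma Compl_spt: "- spt \<mu> = \<Union>{U. open U \<and> emeasure \<mu> U = 0}"
  by (auto simp: spt_def zero_less_iff_neq_zero)

lemma closed_spt: "closed (spt \<mu>)"
  unfolding closed_def Compl_spt by (rule open_Union) simp

text \<open>The complement of the support is a union of open null sets, and by Lindelof countably
  many of them already have the same union.\<close>

lemma measure_spt:
  fixes \<mu> :: "real measure"
  assumes "real_distribution \<mu>"
  shows "measure \<mu> (spt \<mu>) = 1"
proof -
  interpret real_distribution \<mu> by fact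
  define F where "F = {U. open U \<and> emeasure \<mu> U = 0}"
  obtain F' where F': "F' \<subseteq> F" "countable F'" "\<Union>F' = \<Union>F"
    by (rule Lindelof[of F]) (auto simp: F_def)
  have "(\<Union>U\<in>F'. U) \<in> null_sets \<mu>"
    using F'(1,2) by (intro null_sets_UN') (auto simp: F_def null_sets_def)
  then have "- spt \<mu> \<in> null_sets \<mu>" using F'(3) by (simp add: Compl_spt F_def)
  then have "measure \<mu> (- spt \<mu>) = 0" by (simp add: null_sets_def measure_def)
  moreover have "measure \<mu> (space \<mu> - spt \<mu>) = 1 - measure \<mu> (spt \<mu>)"
    by (rule prob_compl) (simp add: closed_spt borel_closed)
  ultimately show ?thesis by (simp add: space_eq_univ Compl_eq_Diff_UNIV)
qed

text \<open>Frees the centre from the support: a ball that meets the support lies in a ball of twice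
  the radius centred at a point of it, and any other ball is null.\<close>

lemma measure_cball_le:
  assumes "kappa_C_measure \<kappa> C \<mu>" and "0 < r"
  shows "measure \<mu> (cball x r) \<le> C * (2 * r) powr \<kappa>"
proof -
  have rd: "real_distribution \<mu>"
    and fr: "\<And>z. z \<in> spt \<mu> \<Longrightarrow> measure \<mu> (cball z (2 * r)) \<le> C * (2 * r) powr \<kappa>"
    using assms by (auto simp: kappa_C_measure_def)
  interpret real_distribution \<mu> by fact
  have "spt \<mu> \<noteq> {}" using measure_spt[OF rd] by auto
  then obtain z0 where "z0 \<in> spt \<mu>" by blast
  \<comment> \<open>The sign of the bound is read off at one point of the support; it settles the
    case of a null ball.\<close>
  have nn: "0 \<le> C * (2 * r) powr \<kappa>"
    using fr[OF \<open>z0 \<in> spt \<mu>\<close>] measure_nonneg[of \<mu> "cball z0 (2 * r)"] by linarith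
  show ?thesis
  proof (cases "cball x r \<inter> spt \<mu> = {}")
    case True
    have "measure \<mu> (cball x r \<union> spt \<mu>) = measure \<mu> (cball x r) + measure \<mu> (spt \<mu>)"
      using True by (intro finite_measure_Union) (auto simp: closed_spt borel_closed)
    then have "measure \<mu> (cball x r) \<le> 0"
      using measure_spt[OF rd] prob_le_1[of "cball x r \<union> spt \<mu>"] by linarith
    then show ?thesis using nn by linarith
  next
    case False
    then obtain z where z: "z \<in> spt \<mu>" "dist x z \<le> r" by auto
    have "measure \<mu> (cball x r) \<le> measure \<mu> (cball z (2 * r))"
    proof (rule finite_measure_mono)
      show "cball x r \<subseteq> cball z (2 * r)"
      proof
        fix y assume "y \<in> cball x r"
        then show "y \<in> cball z (2 * r)"
          using dist_triangle[of z y x] z(2) by (simp add: dist_commute)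
      qed
    qed simp
    then show ?thesis using fr[OF z(1)] by linarith
  qed
qed

text \<open>The total exponent \<open>\<kappa> * card I\<close> is at least 2 and the radius at most
  1, so the product decays at least like the square of the radius.\<close>

lemma prod_measure_cball_le:
  assumes "kappa_C_measure \<kappa> C \<mu>" and "0 < C" and "2 \<le> \<kappa> * real (card I)"
  shows "(\<Prod>i\<in>I. measure \<mu> (cball (y i) (1 / 2 ^ j))) \<le> (C * 2 powr \<kappa>) ^ card I / 4 ^ j"
proof -
  have "(\<Prod>i\<in>I. measure \<mu> (cball (y i) (1 / 2 ^ j))) \<le> (\<Prod>i\<in>I. C * (2 * (1 / 2 ^ j)) powr \<kappa>)"
    using measure_cball_le[OF assms(1), of "1 / 2 ^ j"] by (intro prod_mono conjI measure_nonneg) simp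
  also have "\<dots> = (C * 2 powr \<kappa>) ^ card I * ((1 / 2 ^ j) powr \<kappa>) ^ card I"
  proof -
    have "(2 * (1 / 2 ^ j :: real)) powr \<kappa> = 2 powr \<kappa> * (1 / 2 ^ j) powr \<kappa>"
      by (rule powr_mult)
    then show ?thesis by (simp only: prod_constant power_mult_distrib mult.assoc)
  qed
  also have "((1 / 2 ^ j :: real) powr \<kappa>) ^ card I = (1 / 2 ^ j) powr (\<kappa> * real (card I))"
    by (simp add: powr_powr flip: powr_realpow)
  also have "\<dots> \<le> (1 / 2 ^ j) powr 2"
    using assms(3) by (intro powr_mono') auto
  also have "(1 / 2 ^ j :: real) powr 2 = 1 / 4 ^ j"
  proof -
    have "(1 / 2 ^ j :: real) powr 2 = (1 / 2 ^ j) ^ 2" by (rule powr_numeral) simp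
    also have "\<dots> = 1 / 4 ^ j"
      using power_mult_distrib[of "2 :: real" 2 j] by (simp add: power2_eq_square)
    finally show ?thesis .
  qed
  finally show ?thesis using \<open>0 < C\<close> by (simp add: mult_left_mono)
qed

section \<open>Linear forms whose image contains an interval\<close>

text \<open>Energy estimate and walk combined at the scale 1 / 2^J. The number \<open>q\<close> does
  not depend on \<open>J\<close>; only the form and the error do.\<close>

lemma exists_form_approx_covers:
  fixes C :: real and I :: "'i set"
  assumes \<mu>: "kappa_C_measure \<kappa> C \<mu>" and C: "0 < C" "spt \<mu> \<subseteq> {-C..C}"
    and I: "finite I" "2 \<le> \<kappa> * real (card I)"
    and q: "4 * (real (card I) * C + 2) * (3 + 8 * (C * 2 powr \<kappa>) ^ card I) \<le> real q"
  shows "\<exists>x. (\<forall>i\<in>I. x i \<in> {0..1}) \<and> (\<forall>t. \<bar>t\<bar> \<le> 1 \<longrightarrow>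
    (\<exists>a. (\<forall>i\<in>I. a i \<in> sumprod 1 (2 * q) (spt \<mu>)) \<and> \<bar>t - (\<Sum>i\<in>I. x i * a i)\<bar> \<le> (1 + 4 * real q) / 2 ^ J))"
proof -
  define K where "K = spt \<mu>"
  define B where "B = (C * 2 powr \<kappa>) ^ card I"
  define \<delta> where "\<delta> = 1 / (2 :: real) ^ J"
  have rd: "real_distribution \<mu>" using \<mu> by (simp add: kappa_C_measure_def)
  interpret real_distribution \<mu> by fact
  have B0: "0 \<le> B" using C by (simp add: B_def)
  have \<delta>0: "0 < \<delta>" by (simp add: \<delta>_def)
  have K0: "K \<noteq> {}" using measure_spt[OF rd] by (auto simp: K_def)
  obtain x where x: "\<forall>i\<in>I. x i \<in> {0..1}" and energy:
    "(\<integral>\<^sup>+y. (\<integral>\<^sup>+y'. indicator {-\<delta>..\<delta>} (\<Sum>j\<in>I. x j * (y j - y' j)) \<partial>PiM I (\<lambda>_. \<mu>)) \<partial>PiM I (\<lambda>_. \<mu>))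
    \<le> ennreal ((3 + 8 * B) / 2 ^ J)"
    using exists_form_small_energy[OF prob_space_axioms events_eq_borel I(1) B0
        prod_measure_cball_le[OF \<mu> C(1) I(2), folded B_def], of J] unfolding \<delta>_def by blast
  define S where "S = {\<lfloor>(\<Sum>i\<in>I. x i * y i) / \<delta>\<rfloor> | y. \<forall>i\<in>I. y i \<in> K}"
  \<comment> \<open>The summand 1 absorbs the rounding in \<open>S\<close> and also ensures that
    \<open>L\<close> is at least 2^J, so that every t in [0,1] rounds to an integer in
    [0,L].\<close>
  define L where "L = \<lceil>real (card I) * C + 1\<rceil> * 2 ^ J"
  have L1: "(real (card I) * C + 1) * 2 ^ J \<le> of_int L"
    unfolding L_def by simp
  have L2: "of_int L \<le> (real (card I) * C + 2) * 2 ^ J"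
  proof -
    have "real_of_int \<lceil>real (card I) * C + 1\<rceil> \<le> real (card I) * C + 2" by linarith
    then show ?thesis unfolding L_def by (simp add: mult_right_mono)
  qed
  have SL: "S \<subseteq> {-L..L}"
  proof
    fix s assume "s \<in> S"
    then obtain y where s: "s = \<lfloor>(\<Sum>i\<in>I. x i * y i) / \<delta>\<rfloor>" and y: "\<forall>i\<in>I. y i \<in> K" by (auto simp: S_def)
    have "\<bar>\<Sum>i\<in>I. x i * y i\<bar> \<le> (\<Sum>i\<in>I. \<bar>x i * y i\<bar>)" by (rule sum_abs)
    also have "\<dots> \<le> (\<Sum>i\<in>I. 1 * C)"
    proof (rule sum_mono)
      fix i assume "i \<in> I"
      then have "y i \<in> {-C..C}" "x i \<in> {0..1}" using y C(2) x by (auto simp: K_def)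
      then show "\<bar>x i * y i\<bar> \<le> 1 * C" unfolding abs_mult by (intro mult_mono) auto
    qed
    finally have "\<bar>\<Sum>i\<in>I. x i * y i\<bar> * 2 ^ J \<le> real (card I) * C * 2 ^ J" by simp
    then have "\<bar>(\<Sum>i\<in>I. x i * y i) / \<delta>\<bar> \<le> real (card I) * C * 2 ^ J"
      by (simp add: \<delta>_def abs_mult)
    moreover have "real (card I) * C * 2 ^ J + 1 \<le> of_int L"
      using L1 one_le_power[of "2 :: real" J] unfolding distrib_right by linarith
    ultimately have "- of_int L \<le> (\<Sum>i\<in>I. x i * y i) / \<delta>" "(\<Sum>i\<in>I. x i * y i) / \<delta> < of_int L + 1"
      by linarith+
    then show "s \<in> {-L..L}" by (simp add: s le_floor_iff floor_le_iff)
  qed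
  then have finS: "finite S" using finite_subset by blast
  have "1 \<le> (3 + 8 * B) / 2 ^ J * card S"
  proof (rule card_ge_of_small_energy[OF prob_space_axioms events_eq_borel I(1) _ _ \<delta>0 _ energy finS])
    show "K \<in> sets borel" "measure \<mu> K = 1" by (simp_all add: K_def closed_spt borel_closed measure_spt[OF rd])
    show "\<lfloor>(\<Sum>i\<in>I. x i * y i) / \<delta>\<rfloor> \<in> S" if "\<forall>i\<in>I. y i \<in> K" for y
      using that by (auto simp: S_def)
  qed (use B0 in auto)
  then have card1: "2 ^ J \<le> (3 + 8 * B) * card S" by (simp add: field_simps)
  have "S \<noteq> {}"
  proof
    assume "S = {}"
    then have "(2 :: real) ^ J \<le> 0" using card1 by simp
    moreover have "0 < (2 :: real) ^ J" by simp
    ultimately show False by linarith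
  qed
  have cardS: "0 < real (card S)" using \<open>S \<noteq> {}\<close> finS by (simp add: card_gt_0_iff)
  have "1 \<le> real_of_int L"
  proof -
    have "1 * 1 \<le> (real (card I) * C + 1) * 2 ^ J" using C(1) by (intro mult_mono) auto
    then show ?thesis using L1 by simp
  qed
  \<comment> \<open>Since \<open>L\<close> is at least 1, 3 L + 1 is at most 4 L, which explains the
    factor 4 in the condition on \<open>q\<close>.\<close>
  then have "3 * of_int L + 1 \<le> 4 * ((real (card I) * C + 2) * 2 ^ J)" using L2 by linarith
  also have "\<dots> \<le> 4 * ((real (card I) * C + 2) * ((3 + 8 * B) * card S))"
    using card1 C(1) by (intro mult_left_mono) auto
  also have "\<dots> = (4 * (real (card I) * C + 2) * (3 + 8 * B)) * card S" by simp
  also have "\<dots> \<le> real q * card S"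
    using q cardS by (intro mult_right_mono) (auto simp: B_def)
  also have "\<dots> < real (Suc q) * card S" using cardS by simp
  finally have "real_of_int (3 * L + 1) < real_of_int (int (Suc q) * int (card S))" by simp
  then have L3: "3 * L + 1 < int (Suc q) * int (card S)" by (simp only: of_int_less_iff)
  \<comment> \<open>The walk is known to reach nonnegative integers only; negative t follow from the
    symmetry of \<open>sumprod\<close>.\<close>
  have pos: "\<exists>a. (\<forall>i\<in>I. a i \<in> sumprod 1 (2 * q) K) \<and> \<bar>t - (\<Sum>i\<in>I. x i * a i)\<bar> \<le> (1 + 4 * real q) / 2 ^ J"
    if t: "0 \<le> t" "t \<le> 1" for t
  proof -
    define n where "n = \<lfloor>t / \<delta>\<rfloor>"
    have "0 \<le> n" unfolding n_def using t \<delta>0 by simp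
    have "t * 2 ^ J \<le> 1 * 2 ^ J" using t by (intro mult_right_mono) auto
    also have "\<dots> \<le> (real (card I) * C + 1) * 2 ^ J" using C(1) by (intro mult_right_mono) auto
    also note L1
    finally have "t / \<delta> \<le> of_int L" by (simp add: \<delta>_def)
    then have "n \<le> L" unfolding n_def by linarith
    have "n \<in> int_walk S (2 * q)"
      by (rule int_walk_covers[OF \<open>S \<noteq> {}\<close> SL \<open>0 \<le> n\<close> \<open>n \<le> L\<close> L3])
    then obtain a where a: "\<forall>i\<in>I. a i \<in> sumprod 1 (2 * q) K"
      "\<bar>\<delta> * of_int n - (\<Sum>i\<in>I. x i * a i)\<bar> \<le> 2 * \<delta> * real (2 * q)"
      using int_walk_floor[OF \<delta>0 _ K0] unfolding S_def by blast
    have "of_int n \<le> t / \<delta>" "t / \<delta> \<le> of_int n + 1" unfolding n_def by linarith+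
    then have "\<delta> * of_int n \<le> t" "t \<le> \<delta> * of_int n + \<delta>" using \<delta>0 by (simp_all add: field_simps)
    then have "\<bar>t - (\<Sum>i\<in>I. x i * a i)\<bar> \<le> \<delta> + 2 * \<delta> * real (2 * q)" using a(2) by linarith
    also have "\<dots> = (1 + 4 * real q) / 2 ^ J" by (simp add: \<delta>_def add_divide_distrib)
    finally show ?thesis using a(1) by blast
  qed
  have "\<exists>a. (\<forall>i\<in>I. a i \<in> sumprod 1 (2 * q) K) \<and> \<bar>t - (\<Sum>i\<in>I. x i * a i)\<bar> \<le> (1 + 4 * real q) / 2 ^ J"
    if t: "\<bar>t\<bar> \<le> 1" for t
  proof (cases "0 \<le> t")
    case True
    then show ?thesis using pos t by simp
  next
    case False
    then obtain a where a: "\<forall>i\<in>I. a i \<in> sumprod 1 (2 * q) K"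
      "\<bar>- t - (\<Sum>i\<in>I. x i * a i)\<bar> \<le> (1 + 4 * real q) / 2 ^ J"
      using pos[of "- t"] t by auto
    have "(\<Sum>i\<in>I. x i * (- a i)) = - (\<Sum>i\<in>I. x i * a i)" by (simp add: sum_negf)
    then have "\<bar>t - (\<Sum>i\<in>I. x i * (- a i))\<bar> \<le> (1 + 4 * real q) / 2 ^ J" using a(2) by linarith
    then show ?thesis using a(1) sumprod_uminus by (intro exI[of _ "\<lambda>i. - a i"]) blast
  qed
  then show ?thesis using x unfolding K_def by blast
qed

text \<open>Limit of the approximate statement as \<open>J\<close> tends to infinity: the set of
  arguments is compact and the same at every scale.\<close>

lemma exists_form_covers:
  fixes C :: real and I :: "'i set"
  assumes \<mu>: "kappa_C_measure \<kappa> C \<mu>" and C: "0 < C" "spt \<mu> \<subseteq> {-C..C}"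
    and I: "finite I" "2 \<le> \<kappa> * real (card I)"
    and q: "4 * (real (card I) * C + 2) * (3 + 8 * (C * 2 powr \<kappa>) ^ card I) \<le> real q"
  shows "\<exists>x. (\<forall>i\<in>I. x i \<in> {0..1}) \<and> covers I x (sumprod 1 (2 * q) (spt \<mu>))"
proof -
  have "compact (spt \<mu>)"
    using C(2) closed_spt[of \<mu>] by (metis compact_Icc compact_Int_closed inf.absorb_iff2)
  then have cpt: "compact (sumprod 1 (2 * q) (spt \<mu>))" by (rule compact_sumprod)
  obtain X where X: "\<forall>J. (\<forall>i\<in>I. X J i \<in> {0..1}) \<and> (\<forall>t. \<bar>t\<bar> \<le> 1 \<longrightarrow>
    (\<exists>a. (\<forall>i\<in>I. a i \<in> sumprod 1 (2 * q) (spt \<mu>)) \<and> \<bar>t - (\<Sum>i\<in>I. X J i * a i)\<bar> \<le> (1 + 4 * real q) / 2 ^ J))"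
    using choice[OF allI[OF exists_form_approx_covers[OF assms]]] ..
  have "(\<lambda>J. (1 + 4 * real q) * (1 / 2) ^ J) \<longlonglongrightarrow> (1 + 4 * real q) * 0"
    by (intro tendsto_mult tendsto_const LIMSEQ_realpow_zero) auto
  then have lim: "(\<lambda>J. (1 + 4 * real q) / 2 ^ J) \<longlonglongrightarrow> 0" by (simp add: power_divide)
  show ?thesis
    by (rule covers_limit[OF I(1) cpt _ _ lim, of X]) (use X in blast)+
qed

section \<open>The uniform lower bound for the measure\<close>

theorem theorem1p1:
  fixes \<kappa> C :: real
  assumes "0 < \<kappa>" and "\<kappa> < 1" and "C > 0"
  shows "\<exists>N::nat. \<exists>c\<^sub>0::real. N > 0 \<and> c\<^sub>0 > 0 \<and>
           (\<forall>\<mu>. kappa_C_measure \<kappa> C \<mu> \<longrightarrow> spt \<mu> \<subseteq> {-C..C} \<longrightarrow>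
              emeasure lebesgue
                (diffset (sumset N (prodset N (spt \<mu>))) (sumset N (prodset N (spt \<mu>)))) \<ge> ennreal c\<^sub>0)"
proof -
  define k where "k = nat \<lceil>2 / \<kappa>\<rceil>"
  have "2 / \<kappa> \<le> real (Suc k)" unfolding k_def by linarith
  then have k: "2 \<le> \<kappa> * real (card {..<Suc k})" using assms(1) by (simp add: field_simps)
  define q where "q = nat \<lceil>4 * (real (card {..<Suc k}) * C + 2) * (3 + 8 * (C * 2 powr \<kappa>) ^ card {..<Suc k})\<rceil>"
  have q: "4 * (real (card {..<Suc k}) * C + 2) * (3 + 8 * (C * 2 powr \<kappa>) ^ card {..<Suc k}) \<le> real q"
    unfolding q_def by (rule real_nat_ceiling_ge)
  obtain d m where dm: "\<forall>K (I :: nat set) x. card I = Suc k \<and> K \<noteq> {} \<and> K \<subseteq> {-C..C} \<and>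
    (\<forall>i\<in>I. \<bar>x i\<bar> \<le> 1) \<and> covers I x (sumprod 1 (2 * q) K) \<longrightarrow> {-1..1} \<subseteq> sumprod d m K"
    using interval_subset_sumprod[OF less_imp_le[OF assms(3)], where k = k and d = 1 and m = "2 * q" and 'i = nat]
    by (elim exE that)
  \<comment> \<open>Padding the degree by \<open>m + 1\<close> makes it exceed the number of
    summands, which is then filled up with zeros from \<open>m\<close> to \<open>N\<close>; the
    extra 1 keeps \<open>N\<close> positive.\<close>
  define N where "N = d + (m + 1)"
  \<comment> \<open>Chosen so that \<open>C * (2 * r) powr \<kappa>\<close> equals 1/2: the ball of
    radius \<open>r\<close> about 0 then cannot carry all the mass, and the support has a point
    \<open>z\<close> with |z| > r.\<close>
  define r where "r = (1 / (2 * C)) powr (1 / \<kappa>) / 2"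
  have r0: "0 < r" using assms by (simp add: r_def)
  have Cr: "C * (2 * r) powr \<kappa> < 1" using assms by (simp add: r_def powr_powr)
  define c where "c = r ^ (m + 1)"
  have c0: "0 < c" using r0 by (simp add: c_def)
  have "ennreal (2 * c) \<le> emeasure lebesgue (sumprod N N (spt \<mu>))"
    if \<mu>: "kappa_C_measure \<kappa> C \<mu>" and K: "spt \<mu> \<subseteq> {-C..C}" for \<mu>
  proof -
    have rd: "real_distribution \<mu>" using \<mu> by (simp add: kappa_C_measure_def)
    interpret real_distribution \<mu> by fact
    have K0: "spt \<mu> \<noteq> {}" using measure_spt[OF rd] by auto
    have "compact (spt \<mu>)"
      using K closed_spt[of \<mu>] by (metis compact_Icc compact_Int_closed inf.absorb_iff2)
    then have "compact (sumprod N N (spt \<mu>))" by (rule compact_sumprod)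
    then have meas: "sumprod N N (spt \<mu>) \<in> sets lebesgue" by (simp add: borel_compact)
    obtain x where x: "\<forall>i\<in>{..<Suc k}. x i \<in> {0..1}" "covers {..<Suc k} x (sumprod 1 (2 * q) (spt \<mu>))"
      using exists_form_covers[OF \<mu> assms(3) K finite_lessThan k q] by blast
    have sub: "{-1..1} \<subseteq> sumprod d m (spt \<mu>)"
      using dm[rule_format, of "{..<Suc k}" "spt \<mu>" x] x K K0 by auto
    have "\<not> spt \<mu> \<subseteq> cball 0 r"
    proof
      assume "spt \<mu> \<subseteq> cball 0 r"
      then have "measure \<mu> (spt \<mu>) \<le> measure \<mu> (cball 0 r)" by (intro finite_measure_mono) auto
      then show False using measure_spt[OF rd] measure_cball_le[OF \<mu> r0, of 0] Cr by linarith
    qed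
    then obtain z where z: "z \<in> spt \<mu>" "r < \<bar>z\<bar>" by (auto simp: subset_iff not_le)
    define w where "w = z ^ (m + 1)"
    have cw: "c \<le> \<bar>w\<bar>" unfolding c_def w_def power_abs using z(2) r0 by (intro power_mono) auto
    \<comment> \<open>Padding dilates by \<open>w\<close>, whose size is at least \<open>c\<close>.
      Hence u is written as w times u / w, and u / w lies in [-1,1].\<close>
    have "{-c..c} \<subseteq> sumprod N N (spt \<mu>)"
    proof
      fix u assume u: "u \<in> {-c..c}"
      then have "\<bar>u\<bar> \<le> \<bar>w\<bar>" using cw by auto
      moreover have "w \<noteq> 0" using cw c0 by auto
      ultimately have "\<bar>u / w\<bar> \<le> 1" by (simp add: abs_divide divide_le_eq)
      then have "- 1 \<le> u / w" "u / w \<le> 1" by linarith+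
      then have "u / w \<in> sumprod d m (spt \<mu>)" using sub by auto
      from sumprod_pad_degree[OF this z(1), of "m + 1"]
      have "u \<in> sumprod N m (spt \<mu>)" using \<open>w \<noteq> 0\<close> by (simp add: w_def N_def)
      then show "u \<in> sumprod N N (spt \<mu>)" by (rule sumprod_mono[OF K0, rotated]) (simp add: N_def)
    qed
    then have "emeasure lebesgue {-c..c} \<le> emeasure lebesgue (sumprod N N (spt \<mu>))"
      using meas by (rule emeasure_mono)
    then show ?thesis using c0 by simp
  qed
  then show ?thesis using c0 unfolding sumprod_def
    by (intro exI[of _ N] exI[of _ "2 * c"]) (auto simp: N_def)
qed

end
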